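(* The adjoint operator $\mathcal{R}_{\mathsf s}^*:V_{\mathsf s}\to U$ acting on $w\in V_{\mathsf s}$ can be expressed in the Fourier domain as the series $$\widehat{\mathcal{R}_{\mathsf s}^*w}(\sigma\xi_\theta)=\frac{2}{\sigma}\sum_{n=0}^{\infty}b_n(\theta)J_n(D\sigma),\qquad(\sigma,\theta)\in\mathbb{R}_+\times\mathbb{R}/2\pi\mathbb{Z},$$ where the coefficients $b_n$ are computed as follows. Define $z\in V_{\mathsf s}$ by $z(\gamma,\theta)=w(\gamma,\theta-\gamma)$ for all $(\gamma,\theta)\in\mathbb{R}/\pi\mathbb{Z}\times\mathbb{R}/2\pi\mathbb{Z}$; $z$ being $2\pi$-periodic with respect to $\gamma$, take its Fourier coefficients $$c_n(\theta)=\frac1{2\pi}\int_0^{2\pi}z(\gamma,\theta)e^{-in\gamma}\,d\gamma,$$ and put $$b_n=2\pi\left[c_n+(-1)^n\overline{c_n}\right]\ \text{ for } n\ge1,\qquad b_0=2\pi c_0 .$$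
   Context: $D>0$ is the distance from the source to the origin and $\xi_\theta=(\cos\theta,\sin\theta)^T$. $U$ is the space of feature functions on $\mathbb{R}^2$ (the Schwartz space $\mathcal{S}(\mathbb{R}^2)$, extended to an $L^2$ space when adjoints are considered). $V_{\mathsf s}$ is the space of standard fan-beam sinograms $w(\gamma,\beta)$, with $(\gamma,\beta)\in\mathbb{R}/\pi\mathbb{Z}\times\mathbb{R}/2\pi\mathbb{Z}$. The Radon transform is $\mathcal{R}f(t,\theta)=\int_{\mathbb{R}^2}f(x)\,\delta(t-x\cdot\xi_\theta)\,dx$, and the standard fan-beam Radon transform $\mathcal{R}_{\mathsf s}:U\to V_{\mathsf s}$ is $\mathcal{R}_{\mathsf s}f(\gamma,\beta)=\mathcal{R}f(D\sin\gamma,\beta+\gamma)$. Its adjoint $\mathcal{R}_{\mathsf s}^*$, i.e. the operator with $\langle\mathcal{R}_{\mathsf s}f,w\rangle_{V_{\mathsf s}}=\langle f,\mathcal{R}_{\mathsf s}^*w\rangle_U$ for the $L^2$ inner products, is $$\mathcal{R}_{\mathsf s}^*w(x)=\int_0^{2\pi}\frac1{L_\beta}\,w(\gamma_\beta,\beta)\,d\beta ,$$ where $r_\beta=D(-\sin\beta,\cos\beta)^T$ is the position of the source, $L_\beta=\|r_\beta-x\|_2$, and $\gamma_\beta$ is the (signed) angle of $x$ within the fan, i.e. $\cos\gamma_\beta=\frac1{DL_\beta}\,r_\beta\cdot(r_\beta-x)$, the sign being such that the ray with parameters $(\gamma_\beta,\beta)$ passes through $x$. $J_n$ is the Bessel function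 of the first kind of order $n$, and the bar denotes complex conjugation. The hat on $\mathcal{R}_{\mathsf s}^*w$ denotes the two-dimensional Fourier transform, evaluated at the frequency $\sigma\xi_\theta$ (polar frequency coordinates). It is normalized so that $\widehat{\mathcal{B}p}(\sigma\xi_\theta)=\hat p(\sigma,\theta)/\sigma$ for $\sigma>0$, where $\mathcal{B}p(x)=\int_0^\pi p(x\cdot\xi_\theta,\theta)\,d\theta$ is the parallel backprojection and $\hat p(\sigma,\theta)=\int_{\mathbb{R}}p(t,\theta)e^{-it\sigma}\,dt$.
   Formalization: The prefactor 2/σ is corrected to 1/σ (for w=1 the stated normalization forces 2πJ_0(Dσ)/σ, not 4πJ_0(Dσ)/σ); w is taken real-valued, as the conjugate of c_n requires; the hat is that of a tempered distribution. *)

theory Defs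
  imports "HOL-Analysis.Analysis"
begin

section \<open>The Fourier transform on the plane\<close>

definition unit_vec :: "real \<Rightarrow> real^2" where
  "unit_vec \<theta> = vector [cos \<theta>, sin \<theta>]"

definition partial_deriv :: "2 \<Rightarrow> (real^2 \<Rightarrow> complex) \<Rightarrow> real^2 \<Rightarrow> complex" where
  "partial_deriv i f x = frechet_derivative f (at x) (axis i 1)"

text \<open>Total differentiability of every iterated partial derivative gives smoothness.\<close>

definition schwartz_space :: "(real^2 \<Rightarrow> complex) set" where
  "schwartz_space =
    {f. \<forall>is. (\<forall>x. fold partial_deriv is f differentiable (at x)) \<and>
          (\<forall>k. bounded (range (\<lambda>x. norm x ^ k *\<^sub>R fold partial_deriv is f x)))}"

text \<open>The factor \<open>1 / (2 * pi)\<close> is the one for which the transform of the parallel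
  backprojection \<open>\<integral> p (x \<bullet> unit_vec \<theta>, \<theta>) d\<theta>\<close> over \<open>{0..pi}\<close>, at the frequency
  \<open>\<sigma> *\<^sub>R unit_vec \<theta>\<close>, equals
  \<open>1 / \<sigma>\<close> times the unnormalized one-dimensional transform \<open>\<integral> p (t, \<theta>) exp (- \<i> t \<sigma>) dt\<close>
  (for sinograms with \<open>p (-t, \<theta> + pi) = p (t, \<theta>)\<close>). For example, the backprojection of
  the point mass at \<open>t = 0\<close> is \<open>1 / norm x\<close>, which must be its own transform.\<close>

definition fourier2 :: "(real^2 \<Rightarrow> complex) \<Rightarrow> real^2 \<Rightarrow> complex" where
  "fourier2 \<phi> \<omega> = 1 / (2 * pi) * (LINT x|lborel. \<phi> x * exp (- \<i> * of_real (x \<bullet> \<omega>)))"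

text \<open>A fan-beam backprojection decays only like \<open>1 / norm x\<close>, so in general it is neither
  absolutely nor square integrable, and its Fourier transform is that of a tempered
  distribution. \<open>has_fourier2 f F\<close> says that \<open>f\<close>, as a distribution, has a Fourier transform
  that is represented by the function \<open>F\<close>.\<close>

definition has_fourier2 :: "(real^2 \<Rightarrow> complex) \<Rightarrow> (real^2 \<Rightarrow> complex) \<Rightarrow> bool" where
  "has_fourier2 f F \<longleftrightarrow>
    (\<forall>\<phi>\<in>schwartz_space.
       integrable lborel (\<lambda>x. f x * fourier2 \<phi> x) \<and>
       integrable lborel (\<lambda>\<omega>. F \<omega> * \<phi> \<omega>) \<and>
       (LINT x|lborel. f x * fourier2 \<phi> x) = (LINT \<omega>|lborel. F \<omega> * \<phi> \<omega>))"

section \<open>Bessel functions of the first kind\<close>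

definition bessel_J :: "nat \<Rightarrow> real \<Rightarrow> real" where
  "bessel_J n x = (\<Sum>k. (-1) ^ k / (fact k * fact (n + k)) * (x / 2) ^ (2 * k + n))"

section \<open>The standard fan-beam geometry\<close>

text \<open>Real square-integrable functions on \<open>\<real>/pi\<int> \<times> \<real>/2pi\<int>\<close>, as periodic functions on the
  plane.\<close>

definition fan_sinograms :: "(real \<Rightarrow> real \<Rightarrow> real) set" where
  "fan_sinograms =
    {w. (\<lambda>(\<gamma>, \<beta>). w \<gamma> \<beta>) \<in> borel_measurable borel \<and>
        (\<forall>\<gamma> \<beta>. w (\<gamma> + pi) \<beta> = w \<gamma> \<beta>) \<and>
        (\<forall>\<gamma> \<beta>. w \<gamma> (\<beta> + 2 * pi) = w \<gamma> \<beta>) \<and>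
        set_integrable lborel ({0..pi} \<times> {0..2 * pi}) (\<lambda>(\<gamma>, \<beta>). (w \<gamma> \<beta>)\<^sup>2)}"

definition source :: "real \<Rightarrow> real \<Rightarrow> real^2" where
  "source D \<beta> = vector [- D * sin \<beta>, D * cos \<beta>]"

text \<open>The ray with parameters \<open>(\<gamma>, \<beta>)\<close> is the line
  \<open>{x. x \<bullet> unit_vec (\<beta> + \<gamma>) = D * sin \<gamma>}\<close>; the sign of the fan angle is the one for which
  this line contains \<open>x\<close>. When both signs qualify, the two angles agree modulo \<open>pi\<close>.\<close>

definition fan_angle :: "real \<Rightarrow> real \<Rightarrow> real^2 \<Rightarrow> real" where
  "fan_angle D \<beta> x =
    (let \<gamma> = arccos (source D \<beta> \<bullet> (source D \<beta> - x) / (D * norm (source D \<beta> - x)))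
     in if x \<bullet> unit_vec (\<beta> + \<gamma>) = D * sin \<gamma> then \<gamma> else - \<gamma>)"

definition fan_adjoint :: "real \<Rightarrow> (real \<Rightarrow> real \<Rightarrow> real) \<Rightarrow> real^2 \<Rightarrow> real" where
  "fan_adjoint D w x =
    (LINT \<beta>:{0..2 * pi}|lborel. 1 / norm (source D \<beta> - x) * w (fan_angle D \<beta> x) \<beta>)"

definition fan_shear :: "(real \<Rightarrow> real \<Rightarrow> real) \<Rightarrow> real \<Rightarrow> real \<Rightarrow> real" where
  "fan_shear w \<gamma> \<theta> = w \<gamma> (\<theta> - \<gamma>)"

definition fan_c :: "(real \<Rightarrow> real \<Rightarrow> real) \<Rightarrow> nat \<Rightarrow> real \<Rightarrow> complex" where
  "fan_c w n \<theta> =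
    1 / (2 * pi) *
    (LINT \<gamma>:{0..2 * pi}|lborel. of_real (fan_shear w \<gamma> \<theta>) * exp (- \<i> * of_nat n * of_real \<gamma>))"

definition fan_b :: "(real \<Rightarrow> real \<Rightarrow> real) \<Rightarrow> nat \<Rightarrow> real \<Rightarrow> complex" where
  "fan_b w n \<theta> =
    (if n = 0 then 2 * pi * fan_c w 0 \<theta>
     else 2 * pi * (fan_c w n \<theta> + (-1) ^ n * cnj (fan_c w n \<theta>)))"

end

theory Submission
  imports Defs "HOL-Probability.Probability"
begin

text \<open>The backprojection \<open>fan_adjoint D w\<close> is paired with the Fourier transform of a Schwartz
  function \<open>f\<close>. In polar coordinates \<open>(\<gamma>, r)\<close> around the source at angle \<open>\<beta>\<close>, the Jacobian cancels
  the factor \<open>1 / L\<close> of the backprojection, and what is left is \<open>w \<gamma> \<beta>\<close> times the integral of the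
  transform of \<open>f\<close> along the ray \<open>(\<gamma>, \<beta>)\<close> (\<open>fan_adjoint_pairing\<close>). By the projection slice theorem
  (\<open>projection_slice\<close>) this line integral is
  \<open>\<integral> f (s *\<^sub>R unit_vec (\<beta> + \<gamma>)) * exp (- \<i> s D sin \<gamma>) ds\<close>. With \<open>\<theta> = \<beta> + \<gamma>\<close> and \<open>z = fan_shear w\<close>, and
  after \<open>s *\<^sub>R unit_vec \<theta>\<close> has been read as a frequency in polar coordinates, the pairing becomes
  the integral of \<open>f\<close> against the function with the value
  \<open>1 / \<sigma> * \<integral> z \<gamma> \<theta> * exp (- \<i> D \<sigma> sin \<gamma>) d\<gamma>\<close> at \<open>\<sigma> *\<^sub>R unit_vec \<theta>\<close>, the integral being over
  \<open>{0..2 * pi}\<close> (\<open>has_fourier2_fan_adjoint\<close>). The Jacobi-Anger expansion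
  \<open>exp (- \<i> x sin \<gamma>) = \<Sum>\<^sub>n J\<^sub>n(x) exp (- \<i> n \<gamma>)\<close> over all integers \<open>n\<close>, together with
  \<open>J\<^sub>-\<^sub>n = (- 1)\<^sup>n J\<^sub>n\<close> and \<open>c\<^sub>-\<^sub>n = cnj c\<^sub>n\<close> for real \<open>w\<close>, turns this integral into the series
  (\<open>jacobi_anger\<close>, \<open>fan_phase_integral_series\<close>).

  The angular integrals run over full periods and the radii are signed, so that every point of the plane
  is counted twice; the resulting factors \<open>1 / 2\<close> agree on the two sides. Integrability rests on two
  bounds: \<open>w\<close> is integrable over a period square, being square integrable, and the
  transform of a Schwartz function is integrable along lines, uniformly over those through
  the source positions (\<open>fourier2_line_decay\<close>).\<close>

section \<open>Orthonormal frames in the plane\<close>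

lemma unit_vec_nth [simp]: "unit_vec a $ 1 = cos a" "unit_vec a $ 2 = sin a"
  by (simp_all add: unit_vec_def)

lemma inner_unit_vec: "unit_vec a \<bullet> unit_vec b = cos (a - b)"
  by (simp add: inner_vec_def sum_2 cos_diff)

lemma norm_unit_vec [simp]: "norm (unit_vec a) = 1"
  by (simp add: norm_eq_sqrt_inner inner_unit_vec)

lemma unit_vec_plus_pi [simp]: "unit_vec (a + pi) = - unit_vec a"
  by (simp add: vec_eq_iff forall_2)

lemma unit_vec_plus_2pi [simp]: "unit_vec (a + 2 * pi) = unit_vec a"
  by (simp add: vec_eq_iff forall_2)

lemma unit_vec_add: "unit_vec (a + b) = cos b *\<^sub>R unit_vec a + sin b *\<^sub>R unit_vec (a + pi / 2)"
  by (simp add: vec_eq_iff forall_2 cos_add sin_add algebra_simps)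

lemma continuous_unit_vec [continuous_intros]:
  assumes f: "continuous_on S f"
  shows "continuous_on S (\<lambda>x. unit_vec (f x))"
proof -
  have eq: "unit_vec = (\<lambda>a. cos a *\<^sub>R unit_vec 0 + sin a *\<^sub>R unit_vec (pi / 2))"
    by (simp add: fun_eq_iff vec_eq_iff forall_2)
  have "continuous_on UNIV (\<lambda>a. cos a *\<^sub>R unit_vec 0 + sin a *\<^sub>R unit_vec (pi / 2))"
    by (intro continuous_intros)
  then have "continuous_on UNIV unit_vec"
    by (subst eq)
  then show ?thesis
    by (rule continuous_on_compose2[OF _ f]) simp
qed

lemma measurable_unit_vec [measurable]: "unit_vec \<in> borel_measurable borel"
  by (intro borel_measurable_continuous_onI continuous_unit_vec continuous_on_id)

lemma lborel_vec2:
  "(lborel :: (real^2) measure) = distr (lborel \<Otimes>\<^sub>M lborel) borel (\<lambda>(s, t). vector [s, t])"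
proof (rule lborel_eqI)
  let ?v = "\<lambda>(s, t). vector [s, t] :: real^2"
  have "?v = (\<lambda>q. fst q *\<^sub>R unit_vec 0 + snd q *\<^sub>R unit_vec (pi / 2))"
    by (auto simp: vec_eq_iff forall_2)
  then have [measurable]: "?v \<in> borel_measurable (lborel \<Otimes>\<^sub>M lborel)"
    by simp
  fix l u :: "real^2"
  assume le: "\<And>b. b \<in> Basis \<Longrightarrow> l \<bullet> b \<le> u \<bullet> b"
  have le': "l $ i \<le> u $ i" for i
    using le[of "axis i 1"] by (simp add: inner_axis axis_in_Basis_iff)
  have "?v -` box l u = {l $ 1<..<u $ 1} \<times> {l $ 2<..<u $ 2}"
    by (auto simp: mem_box_cart forall_2)
  then have "emeasure (distr (lborel \<Otimes>\<^sub>M lborel) borel ?v) (box l u)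
      = emeasure (lborel \<Otimes>\<^sub>M lborel) ({l $ 1<..<u $ 1} \<times> {l $ 2<..<u $ 2})"
    by (subst emeasure_distr) (auto simp: space_pair_measure)
  also have "\<dots> = ennreal (u $ 1 - l $ 1) * ennreal (u $ 2 - l $ 2)"
    by (subst lborel.emeasure_pair_measure_Times) (auto simp: le')
  also have "\<dots> = ennreal ((u - l) $ 1 * (u - l) $ 2)"
    using le' by (simp add: ennreal_mult)
  also have "(u - l) $ 1 * (u - l) $ 2 = (\<Prod>i\<in>UNIV. (u - l) $ i)"
    by (simp add: UNIV_2)
  also have "\<dots> = (\<Prod>b\<in>Basis. (u - l) \<bullet> b)"
  proof -
    have B: "(Basis :: (real^2) set) = (\<lambda>i. axis i 1) ` UNIV"
      by (auto simp: Basis_vec_def)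
    have "inj_on (\<lambda>i::2. axis i (1::real)) UNIV"
      by (auto simp: inj_on_def axis_eq_axis)
    then show ?thesis
      unfolding B by (subst prod.reindex) (auto simp: inner_axis)
  qed
  finally show "emeasure (distr (lborel \<Otimes>\<^sub>M lborel) borel ?v) (box l u)
      = ennreal (\<Prod>b\<in>Basis. (u - l) \<bullet> b)" .
qed simp

lemma lborel_orthogonal:
  fixes f :: "real^'n::{finite,wellorder} \<Rightarrow> real^'n::_"
  assumes "orthogonal_transformation f"
  shows "lborel = distr lborel borel f"
proof (rule lborel_eqI)
  have [measurable]: "f \<in> borel_measurable borel"
    using assms by (intro borel_measurable_continuous_onI linear_continuous_on)
      (simp add: orthogonal_transformation_linear flip: linear_conv_bounded_linear)
  fix l u :: "real^'n::{finite,wellorder}"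
  assume le: "\<And>b. b \<in> Basis \<Longrightarrow> l \<bullet> b \<le> u \<bullet> b"
  have o: "orthogonal_transformation (inv f)"
    using assms by (rule orthogonal_transformation_inv)
  have "f -` box l u = inv f ` box l u"
    using assms by (simp add: bij_vimage_eq_inv_image orthogonal_transformation_bij)
  moreover have bm: "f -` box l u \<in> sets borel"
    using measurable_sets_borel[of f borel "box l u"] by simp
  ultimately have "emeasure (distr lborel borel f) (box l u) = emeasure lebesgue (inv f ` box l u)"
    by (subst emeasure_distr) auto
  also have "\<dots> = ennreal (measure lebesgue (inv f ` box l u))"
    using measurable_orthogonal_image[OF o, of "box l u"]
    by (intro emeasure_eq_measure2) auto
  also have "\<dots> = ennreal (measure lebesgue (box l u))"
    using measure_orthogonal_image[OF o, of "box l u"] by simp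
  also have "\<dots> = ennreal (\<Prod>b\<in>Basis. (u - l) \<bullet> b)"
    using le by (simp add: measure_lborel_box_eq)
  finally show "emeasure (distr lborel borel f) (box l u) = ennreal (\<Prod>b\<in>Basis. (u - l) \<bullet> b)" .
qed simp

text \<open>Lebesgue measure on the plane in the orthonormal frame
  \<open>(unit_vec a, unit_vec (a + pi / 2))\<close> with origin \<open>p\<close>.\<close>

lemma lborel_frame:
  "lborel = distr (lborel \<Otimes>\<^sub>M lborel) borel
     (\<lambda>(s, t). p + s *\<^sub>R unit_vec a + t *\<^sub>R unit_vec (a + pi / 2))"
proof -
  let ?f = "\<lambda>x::real^2. x $ 1 *\<^sub>R unit_vec a + x $ 2 *\<^sub>R unit_vec (a + pi / 2)"
  let ?v = "\<lambda>(s, t). vector [s, t] :: real^2"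
  have "?v = (\<lambda>q. fst q *\<^sub>R unit_vec 0 + snd q *\<^sub>R unit_vec (pi / 2))"
    by (auto simp: vec_eq_iff forall_2)
  then have [measurable]: "?v \<in> borel_measurable (lborel \<Otimes>\<^sub>M lborel)"
    by simp
  have "linear ?f"
    by (intro linearI) (simp_all add: algebra_simps)
  moreover have "norm (?f x) = norm x" for x
  proof -
    have "(norm (?f x))\<^sup>2 = (x $ 1)\<^sup>2 + (x $ 2)\<^sup>2"
      unfolding power2_norm_eq_inner
      by (simp add: inner_add_left inner_add_right inner_unit_vec power2_eq_square)
    also have "\<dots> = (norm x)\<^sup>2"
      unfolding power2_norm_eq_inner by (simp add: inner_vec_def sum_2 power2_eq_square)
    finally show ?thesis by simp
  qed
  ultimately have o: "orthogonal_transformation ?f"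
    by (simp add: orthogonal_transformation)
  have [measurable]: "?f \<in> borel_measurable borel"
    using \<open>linear ?f\<close> by (intro borel_measurable_continuous_onI linear_continuous_on)
      (simp add: linear_conv_bounded_linear)
  have "lborel = distr (distr lborel borel ?f) borel ((+) p)"
    by (simp add: lborel_orthogonal[OF o, symmetric] lborel_distr_plus)
  also have "\<dots> = distr (distr (distr (lborel \<Otimes>\<^sub>M lborel) borel ?v) borel ?f) borel ((+) p)"
    by (simp add: lborel_vec2[symmetric])
  also have "\<dots> = distr (lborel \<Otimes>\<^sub>M lborel) borel ((+) p \<circ> (?f \<circ> ?v))"
    by (simp add: distr_distr comp_assoc)
  also have "(+) p \<circ> (?f \<circ> ?v) = (\<lambda>(s, t). p + s *\<^sub>R unit_vec a + t *\<^sub>R unit_vec (a + pi / 2))"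
    by (auto simp: fun_eq_iff)
  finally show ?thesis .
qed

section \<open>Integrals of periodic functions\<close>

lemma periodic_of_int:
  fixes f :: "real \<Rightarrow> 'a" and k :: int
  assumes "\<And>x. f (x + T) = f x"
  shows "f (x + of_int k * T) = f x"
proof (induction k arbitrary: x rule: int_induct[where k = 0])
  case (step1 i)
  then show ?case using assms[of "x + of_int i * T"] by (simp add: algebra_simps)
next
  case (step2 i)
  then show ?case using assms[of "x + of_int (i - 1) * T"] by (simp add: algebra_simps)
qed simp

lemma nn_integral_split:
  fixes f :: "real \<Rightarrow> ennreal"
  assumes [measurable]: "f \<in> borel_measurable borel" and "a \<le> c" "c \<le> b"
  shows "(\<integral>\<^sup>+x\<in>{a..b}. f x \<partial>lborel) = (\<integral>\<^sup>+x\<in>{a..c}. f x \<partial>lborel) + (\<integral>\<^sup>+x\<in>{c..b}. f x \<partial>lborel)"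
proof -
  have "AE x in lborel. x \<noteq> c" by (rule AE_lborel_singleton)
  then have "(\<integral>\<^sup>+x\<in>{a..b}. f x \<partial>lborel)
      = (\<integral>\<^sup>+x. f x * indicator {a..c} x + f x * indicator {c..b} x \<partial>lborel)"
    using assms(2,3) by (intro nn_integral_cong_AE) (auto simp: indicator_def)
  then show ?thesis by (simp add: nn_integral_add)
qed

lemma nn_integral_shift:
  fixes f :: "real \<Rightarrow> ennreal"
  assumes [measurable]: "f \<in> borel_measurable borel" and "\<And>x. f (x + c) = f x"
  shows "(\<integral>\<^sup>+x\<in>{a + c..b + c}. f x \<partial>lborel) = (\<integral>\<^sup>+x\<in>{a..b}. f x \<partial>lborel)"
proof -
  have "(\<integral>\<^sup>+x\<in>{a + c..b + c}. f x \<partial>lborel)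
      = ennreal \<bar>1\<bar> * (\<integral>\<^sup>+x. f (c + 1 * x) * indicator {a + c..b + c} (c + 1 * x) \<partial>lborel)"
    by (rule nn_integral_real_affine) auto
  also have "\<dots> = (\<integral>\<^sup>+x\<in>{a..b}. f x \<partial>lborel)"
    using assms(2) by (auto intro!: nn_integral_cong simp: add.commute[of c] split: split_indicator)
  finally show ?thesis .
qed

lemma nn_integral_periodic:
  fixes f :: "real \<Rightarrow> ennreal"
  assumes [measurable]: "f \<in> borel_measurable borel" and "T > 0" and per: "\<And>x. f (x + T) = f x"
  shows "(\<integral>\<^sup>+x\<in>{a..a + T}. f x \<partial>lborel) = (\<integral>\<^sup>+x\<in>{0..T}. f x \<partial>lborel)"
proof -
  define c where "c = of_int \<lceil>a / T\<rceil> * T"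
  have "a / T \<le> of_int \<lceil>a / T\<rceil>" "of_int \<lceil>a / T\<rceil> < a / T + 1"
    by linarith+
  then have "a \<le> c" "c \<le> a + T"
    using \<open>T > 0\<close> mult_right_mono[of "a / T" "of_int \<lceil>a / T\<rceil>" T]
      mult_strict_right_mono[of "of_int \<lceil>a / T\<rceil>" "a / T + 1" T]
    by (auto simp: c_def distrib_right)
  then have "(\<integral>\<^sup>+x\<in>{a..a + T}. f x \<partial>lborel)
      = (\<integral>\<^sup>+x\<in>{c..a + T}. f x \<partial>lborel) + (\<integral>\<^sup>+x\<in>{a..c}. f x \<partial>lborel)"
    by (subst nn_integral_split[of f a c]) (auto simp: add.commute)
  also have "(\<integral>\<^sup>+x\<in>{a..c}. f x \<partial>lborel) = (\<integral>\<^sup>+x\<in>{a + T..c + T}. f x \<partial>lborel)"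
    by (rule nn_integral_shift[symmetric]) (auto simp: per)
  also have "(\<integral>\<^sup>+x\<in>{c..a + T}. f x \<partial>lborel) + \<dots> = (\<integral>\<^sup>+x\<in>{0 + c..T + c}. f x \<partial>lborel)"
    using \<open>a \<le> c\<close> \<open>c \<le> a + T\<close> by (subst nn_integral_split[of f "0 + c" "a + T"]) (auto simp: add.commute)
  also have "\<dots> = (\<integral>\<^sup>+x\<in>{0..T}. f x \<partial>lborel)"
    by (rule nn_integral_shift) (auto simp: c_def periodic_of_int[of f, OF per])
  finally show ?thesis .
qed

text \<open>Integrability is part of the statement, so that the equation also covers non-integrable
  functions, whose integral is \<open>0\<close> by convention.\<close>

lemma periodic_integral:
  fixes f :: "real \<Rightarrow> 'a::{banach, second_countable_topology}"
  assumes [measurable]: "f \<in> borel_measurable borel" and "T > 0" and per: "\<And>x. f (x + T) = f x"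
  shows "set_integrable lborel {a..a + T} f \<longleftrightarrow> set_integrable lborel {0..T} f"
    and "(LINT x:{a..a + T}|lborel. f x) = (LINT x:{0..T}|lborel. f x)"
proof -
  \<comment> \<open>The reduction modulo \<open>T\<close> maps Lebesgue measure on \<open>{a..a + T}\<close> to a measure \<open>?M a\<close> that does not depend on \<open>a\<close>.\<close>
  define m where "m x = x - of_int \<lfloor>x / T\<rfloor> * T" for x
  have [measurable]: "m \<in> borel_measurable borel"
    unfolding m_def by measurable
  have fm: "f (m x) = f x" for x
    using periodic_of_int[of f T x "- \<lfloor>x / T\<rfloor>", OF per] by (simp add: m_def)
  have mT: "m (x + T) = m x" for x
    using \<open>T > 0\<close> by (simp add: m_def add_divide_distrib algebra_simps)
  let ?M = "\<lambda>a. distr (density lborel (indicator {a..a + T})) borel m"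
  have M: "?M a = ?M 0"
  proof (rule measure_eqI)
    fix A assume "A \<in> sets (?M a)"
    then have [measurable]: "A \<in> sets borel" by simp
    have *: "emeasure (?M b) A = (\<integral>\<^sup>+x\<in>{b..b + T}. indicator A (m x) \<partial>lborel)" for b
    proof -
      have "emeasure (?M b) A = (\<integral>\<^sup>+x. indicator A x \<partial>?M b)" by simp
      also have "\<dots> = (\<integral>\<^sup>+x\<in>{b..b + T}. indicator A (m x) \<partial>lborel)"
        by (simp add: nn_integral_distr nn_integral_density mult.commute del: nn_integral_indicator)
      finally show ?thesis .
    qed
    show "emeasure (?M a) A = emeasure (?M 0) A"
      unfolding * by (simp add: nn_integral_periodic[OF _ \<open>T > 0\<close>] mT)
  qed simp
  have 1: "set_integrable lborel {b..b + T} f \<longleftrightarrow> integrable (?M b) f" for b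
  proof -
    have "density lborel (indicator {b..b + T}) = density lborel (\<lambda>x. ennreal (indicator {b..b + T} x))"
      by (simp add: ennreal_indicator)
    then show ?thesis
      by (simp add: integrable_distr_eq fm set_integrable_def integrable_density)
  qed
  have 2: "(LINT x:{b..b + T}|lborel. f x) = integral\<^sup>L (?M b) f" for b
  proof -
    have "density lborel (indicator {b..b + T}) = density lborel (\<lambda>x. ennreal (indicator {b..b + T} x))"
      by (simp add: ennreal_indicator)
    then show ?thesis
      by (simp add: integral_distr fm set_lebesgue_integral_def integral_density)
  qed
  show "set_integrable lborel {a..a + T} f \<longleftrightarrow> set_integrable lborel {0..T} f"
    using 1[of a] 1[of 0] M by simp
  show "(LINT x:{a..a + T}|lborel. f x) = (LINT x:{0..T}|lborel. f x)"
    using 2[of a] 2[of 0] M by simp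
qed

section \<open>Polar coordinates with a signed radius\<close>

lemma nn_integral_tan:
  fixes k :: "real \<Rightarrow> ennreal"
  assumes [measurable]: "k \<in> borel_measurable borel"
  shows "(\<integral>\<^sup>+u. k u \<partial>lborel)
    = (\<integral>\<^sup>+\<theta>\<in>{-(pi/2)<..<pi/2}. k (tan \<theta>) * ennreal (inverse ((cos \<theta>)\<^sup>2)) \<partial>lborel)"
proof (rule LIMSEQ_unique)
  let ?g = "\<lambda>\<theta>. k (tan \<theta>) * ennreal (inverse ((cos \<theta>)\<^sup>2))"
  \<comment> \<open>The substitution on the compact intervals \<open>?I n\<close>, which exhaust the open interval.\<close>
  let ?I = "\<lambda>n. {- arctan (real (Suc n))..arctan (real (Suc n))}"
  have [measurable]: "(tan :: real \<Rightarrow> real) \<in> borel_measurable borel"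
    unfolding tan_def by measurable
  have inn: "- (pi / 2) < \<theta> \<and> \<theta> < pi / 2" if "\<theta> \<in> ?I n" for \<theta> n
    using that arctan_bounded[of "real (Suc n)"] by auto
  have eq: "(\<integral>\<^sup>+u\<in>{- real (Suc n)..real (Suc n)}. k u \<partial>lborel) = (\<integral>\<^sup>+\<theta>\<in>?I n. ?g \<theta> \<partial>lborel)" for n
  proof -
    have "(\<integral>\<^sup>+u. k u * indicator {tan (- arctan (real (Suc n)))..tan (arctan (real (Suc n)))} u \<partial>lborel)
      = (\<integral>\<^sup>+\<theta>\<in>?I n. ?g \<theta> \<partial>lborel)"
    proof (rule nn_integral_substitution_aux)
      fix x assume x: "x \<in> ?I n"
      then have "cos x > 0" using inn[OF x] by (intro cos_gt_zero_pi) auto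
      then show "(tan has_real_derivative inverse ((cos x)\<^sup>2)) (at x)"
        by (intro DERIV_tan) simp
      show "0 \<le> inverse ((cos x)\<^sup>2)" by simp
    next
      have "cos x \<noteq> 0" if "x \<in> ?I n" for x
        using cos_gt_zero_pi[of x] inn[OF that] by auto
      then show "continuous_on (?I n) (\<lambda>x. inverse ((cos x)\<^sup>2))"
        by (intro continuous_intros) auto
    next
      have "arctan (real (Suc n)) > 0" by simp
      then show "- arctan (real (Suc n)) < arctan (real (Suc n))" by linarith
    qed auto
    then show ?thesis by (simp add: tan_arctan)
  qed
  show "(\<lambda>n. \<integral>\<^sup>+u\<in>{- real (Suc n)..real (Suc n)}. k u \<partial>lborel) \<longlonglongrightarrow> (\<integral>\<^sup>+u. k u \<partial>lborel)"
  proof (rule nn_integral_LIMSEQ)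
    show "incseq (\<lambda>n u. k u * indicator {- real (Suc n)..real (Suc n)} u)"
      by (auto simp: incseq_def le_fun_def intro!: mult_left_mono split: split_indicator)
    fix u
    have "eventually (\<lambda>n. \<bar>u\<bar> \<le> real n) sequentially"
      using eventually_ge_at_top[of "nat \<lceil>\<bar>u\<bar>\<rceil>"] by eventually_elim linarith
    then have "eventually (\<lambda>n. k u * indicator {- real (Suc n)..real (Suc n)} u = k u) sequentially"
      by eventually_elim (auto simp: indicator_def)
    then show "(\<lambda>n. k u * indicator {- real (Suc n)..real (Suc n)} u) \<longlonglongrightarrow> k u"
      by (rule tendsto_eventually)
  qed measurable
  show "(\<lambda>n. \<integral>\<^sup>+u\<in>{- real (Suc n)..real (Suc n)}. k u \<partial>lborel)
      \<longlonglongrightarrow> (\<integral>\<^sup>+\<theta>\<in>{-(pi/2)<..<pi/2}. ?g \<theta> \<partial>lborel)"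
    unfolding eq
  proof (rule nn_integral_LIMSEQ)
    have "arctan (real (Suc m)) \<le> arctan (real (Suc n))" if "m \<le> n" for m n
      using that by (simp add: arctan_le_iff)
    then have "?I m \<subseteq> ?I n" if "m \<le> n" for m n
      using that by fastforce
    note sub = this
    show "incseq (\<lambda>n \<theta>. ?g \<theta> * indicator (?I n) \<theta>)"
      unfolding incseq_def le_fun_def
    proof (intro allI impI mult_left_mono)
      fix m n :: nat and x assume "m \<le> n"
      then show "indicator (?I m) x \<le> (indicator (?I n) x :: ennreal)"
        using sub[of m n] by (auto simp: indicator_def)
    qed simp
    fix \<theta>
    show "(\<lambda>n. ?g \<theta> * indicator (?I n) \<theta>) \<longlonglongrightarrow> ?g \<theta> * indicator {-(pi/2)<..<pi/2} \<theta>"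
    proof (cases "\<theta> \<in> {-(pi/2)<..<pi/2}")
      case True
      have "eventually (\<lambda>n. \<bar>tan \<theta>\<bar> \<le> real n) sequentially"
        using eventually_ge_at_top[of "nat \<lceil>\<bar>tan \<theta>\<bar>\<rceil>"] by eventually_elim linarith
      then have "eventually (\<lambda>n. \<theta> \<in> ?I n) sequentially"
      proof eventually_elim
        case (elim n)
        have "arctan (- real (Suc n)) \<le> arctan (tan \<theta>)" "arctan (tan \<theta>) \<le> arctan (real (Suc n))"
          using elim unfolding arctan_le_iff by auto
        moreover have "arctan (tan \<theta>) = \<theta>"
          using True by (intro arctan_tan) auto
        ultimately show ?case unfolding arctan_minus by auto
      qed
      then have "eventually (\<lambda>n. ?g \<theta> * indicator (?I n) \<theta> = ?g \<theta> * indicator {-(pi/2)<..<pi/2} \<theta>) sequentially"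
        by (rule eventually_mono) (use True in \<open>simp add: indicator_def\<close>)
      then show ?thesis
        by (rule tendsto_eventually)
    next
      case False
      then have "\<theta> \<notin> ?I n" for n
        using inn[of \<theta> n] by auto
      then show ?thesis using False by simp
    qed
  qed measurable
qed

text \<open>Polar coordinates with a full circle of directions and a signed radius: every point is hit
  twice, whence the weight \<open>\<bar>r\<bar> / 2\<close>. Signed radii are what a full line through the source needs.
  The proof substitutes \<open>t = s u\<close> in Cartesian coordinates \<open>(s, t)\<close>, then \<open>u = tan \<theta>\<close> and
  \<open>s = r cos \<theta>\<close>; this sweeps the angles in \<open>{-pi/2..pi/2}\<close>, and the integrand is \<open>pi\<close>-periodic
  in the angle.\<close>

lemma nn_integral_polar:
  fixes h :: "real^2 \<Rightarrow> ennreal"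
  assumes [measurable]: "h \<in> borel_measurable borel"
  shows "(\<integral>\<^sup>+x. h x \<partial>lborel) =
    (\<integral>\<^sup>+\<theta>\<in>{0..2 * pi}. (\<integral>\<^sup>+r. ennreal (\<bar>r\<bar> / 2) * h (p + r *\<^sub>R unit_vec (a + \<theta>)) \<partial>lborel) \<partial>lborel)"
proof -
  define K where "K \<theta> = (\<integral>\<^sup>+r. ennreal \<bar>r\<bar> * h (p + r *\<^sub>R unit_vec (a + \<theta>)) \<partial>lborel)" for \<theta>
  have [measurable]: "K \<in> borel_measurable borel"
    unfolding K_def by measurable
  let ?e = "unit_vec a" and ?e' = "unit_vec (a + pi / 2)"
  let ?k = "\<lambda>u. \<integral>\<^sup>+s. ennreal \<bar>s\<bar> * h (p + s *\<^sub>R (?e + u *\<^sub>R ?e')) \<partial>lborel"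
  have "(\<integral>\<^sup>+x. h x \<partial>lborel) = (\<integral>\<^sup>+q. h (p + fst q *\<^sub>R ?e + snd q *\<^sub>R ?e') \<partial>(lborel \<Otimes>\<^sub>M lborel))"
    by (subst lborel_frame[of p a]) (simp add: nn_integral_distr case_prod_beta)
  also have "\<dots> = (\<integral>\<^sup>+s. \<integral>\<^sup>+t. h (p + s *\<^sub>R ?e + t *\<^sub>R ?e') \<partial>lborel \<partial>lborel)"
    by (subst lborel.nn_integral_fst[symmetric]) auto
  also have "\<dots> = (\<integral>\<^sup>+s. \<integral>\<^sup>+u. ennreal \<bar>s\<bar> * h (p + s *\<^sub>R (?e + u *\<^sub>R ?e')) \<partial>lborel \<partial>lborel)"
  proof (rule nn_integral_cong_AE)
    have "AE s in lborel. s \<noteq> (0::real)" by (rule AE_lborel_singleton)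
    then show "AE s in lborel. (\<integral>\<^sup>+t. h (p + s *\<^sub>R ?e + t *\<^sub>R ?e') \<partial>lborel)
        = (\<integral>\<^sup>+u. ennreal \<bar>s\<bar> * h (p + s *\<^sub>R (?e + u *\<^sub>R ?e')) \<partial>lborel)"
    proof eventually_elim
      case (elim s)
      show ?case
        by (subst nn_integral_real_affine[OF _ elim, of _ 0])
           (auto simp: nn_integral_cmult scaleR_add_right add.assoc)
    qed
  qed
  also have "\<dots> = (\<integral>\<^sup>+u. ?k u \<partial>lborel)"
    by (rule lborel_pair.Fubini') measurable
  also have "\<dots> = (\<integral>\<^sup>+\<theta>\<in>{-(pi/2)<..<pi/2}. ?k (tan \<theta>) * ennreal (inverse ((cos \<theta>)\<^sup>2)) \<partial>lborel)"
    by (rule nn_integral_tan) measurable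
  also have "\<dots> = (\<integral>\<^sup>+\<theta>\<in>{-(pi/2)..-(pi/2) + pi}. K \<theta> \<partial>lborel)"
  proof (rule nn_integral_cong_AE)
    have "AE \<theta> in lborel. \<theta> \<noteq> pi / 2" "AE \<theta> in lborel. \<theta> \<noteq> - (pi / 2)"
      by (rule AE_lborel_singleton)+
    then show "AE \<theta> in lborel. ?k (tan \<theta>) * ennreal (inverse ((cos \<theta>)\<^sup>2)) * indicator {-(pi/2)<..<pi/2} \<theta>
        = K \<theta> * indicator {-(pi/2)..-(pi/2) + pi} \<theta>"
    proof eventually_elim
      case (elim \<theta>)
      show ?case
      proof (cases "\<theta> \<in> {-(pi/2)<..<pi/2}")
        case True
        then have c: "cos \<theta> > 0" by (intro cos_gt_zero_pi) auto
        have v: "cos \<theta> *\<^sub>R (?e + tan \<theta> *\<^sub>R ?e') = unit_vec (a + \<theta>)"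
          using c by (simp add: unit_vec_add[of a \<theta>] scaleR_add_right tan_def)
        \<comment> \<open>The substitution \<open>s = r cos \<theta>\<close> contributes \<open>(cos \<theta>)\<^sup>2\<close>, which cancels the derivative of \<open>tan\<close>.\<close>
        have "?k (tan \<theta>) = ennreal \<bar>cos \<theta>\<bar> * (\<integral>\<^sup>+r. ennreal \<bar>0 + cos \<theta> * r\<bar>
            * h (p + (0 + cos \<theta> * r) *\<^sub>R (?e + tan \<theta> *\<^sub>R ?e')) \<partial>lborel)"
          using c by (intro nn_integral_real_affine) auto
        also have "(\<lambda>r. ennreal \<bar>0 + cos \<theta> * r\<bar> * h (p + (0 + cos \<theta> * r) *\<^sub>R (?e + tan \<theta> *\<^sub>R ?e')))
            = (\<lambda>r. ennreal (cos \<theta>) * (ennreal \<bar>r\<bar> * h (p + r *\<^sub>R unit_vec (a + \<theta>))))"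
          using c by (simp add: v[symmetric] abs_mult ennreal_mult mult.assoc mult.commute[of _ "cos \<theta>"])
        also have "ennreal \<bar>cos \<theta>\<bar> * (\<integral>\<^sup>+r. ennreal (cos \<theta>) * (ennreal \<bar>r\<bar> * h (p + r *\<^sub>R unit_vec (a + \<theta>))) \<partial>lborel)
            = ennreal ((cos \<theta>)\<^sup>2) * K \<theta>"
          using c by (simp add: nn_integral_cmult K_def power2_eq_square ennreal_mult mult.assoc)
        finally have "?k (tan \<theta>) * ennreal (inverse ((cos \<theta>)\<^sup>2))
            = ennreal ((cos \<theta>)\<^sup>2) * ennreal (inverse ((cos \<theta>)\<^sup>2)) * K \<theta>"
          by (simp add: ac_simps)
        also have "ennreal ((cos \<theta>)\<^sup>2) * ennreal (inverse ((cos \<theta>)\<^sup>2)) = 1"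
          using c by (simp flip: ennreal_mult)
        finally show ?thesis using True by (auto simp: indicator_def)
      next
        case False
        then show ?thesis using elim by (auto simp: indicator_def)
      qed
    qed
  qed
  also have "\<dots> = (\<integral>\<^sup>+\<theta>\<in>{0..2 * pi}. K \<theta> * ennreal (1 / 2) \<partial>lborel)"
  proof -
    have per: "K (\<theta> + pi) = K \<theta>" for \<theta>
    proof -
      have "K (\<theta> + pi) = ennreal \<bar>- 1\<bar> * (\<integral>\<^sup>+r. ennreal \<bar>0 + - 1 * r\<bar>
          * h (p + (0 + - 1 * r) *\<^sub>R unit_vec (a + (\<theta> + pi))) \<partial>lborel)"
        unfolding K_def by (rule nn_integral_real_affine) auto
      also have "\<dots> = K \<theta>"
        by (simp add: K_def flip: add.assoc)
      finally show ?thesis .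
    qed
    have "(\<integral>\<^sup>+\<theta>\<in>{0..2 * pi}. K \<theta> \<partial>lborel)
        = (\<integral>\<^sup>+\<theta>\<in>{0..pi}. K \<theta> \<partial>lborel) + (\<integral>\<^sup>+\<theta>\<in>{pi..pi + pi}. K \<theta> \<partial>lborel)"
      by (subst nn_integral_split[of K 0 pi]) auto
    also have "\<dots> = 2 * (\<integral>\<^sup>+\<theta>\<in>{-(pi/2)..-(pi/2) + pi}. K \<theta> \<partial>lborel)"
      using nn_integral_periodic[of K pi "-(pi/2)", OF _ pi_gt_zero per]
        nn_integral_periodic[of K pi pi, OF _ pi_gt_zero per]
      by (simp only: mult_2 \<open>K \<in> borel_measurable borel\<close> simp_thms)
    finally have "(\<integral>\<^sup>+\<theta>\<in>{0..2 * pi}. K \<theta> \<partial>lborel) * ennreal (1 / 2)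
        = (\<integral>\<^sup>+\<theta>\<in>{-(pi/2)..-(pi/2) + pi}. K \<theta> \<partial>lborel) * (ennreal 2 * ennreal (1 / 2))"
      by (simp add: ac_simps)
    also have "ennreal 2 * ennreal (1 / 2) = 1"
      by (subst ennreal_mult[symmetric]) auto
    finally have "(\<integral>\<^sup>+\<theta>\<in>{0..2 * pi}. K \<theta> \<partial>lborel) * ennreal (1 / 2)
        = (\<integral>\<^sup>+\<theta>\<in>{-(pi/2)..-(pi/2) + pi}. K \<theta> \<partial>lborel)"
      by simp
    moreover have "(\<integral>\<^sup>+\<theta>\<in>{0..2 * pi}. K \<theta> * ennreal (1 / 2) \<partial>lborel)
        = (\<integral>\<^sup>+\<theta>\<in>{0..2 * pi}. K \<theta> \<partial>lborel) * ennreal (1 / 2)"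
      by (subst nn_integral_multc[symmetric]) (auto intro!: nn_integral_cong simp only: ac_simps, measurable)
    ultimately show ?thesis by simp
  qed
  also have "\<dots> = (\<integral>\<^sup>+\<theta>\<in>{0..2 * pi}. (\<integral>\<^sup>+r. ennreal (\<bar>r\<bar> / 2) * h (p + r *\<^sub>R unit_vec (a + \<theta>)) \<partial>lborel) \<partial>lborel)"
  proof (intro nn_integral_cong arg_cong2[where f = "(*)"] refl)
    fix \<theta> :: real
    have "ennreal (\<bar>r\<bar> / 2) = ennreal (1 / 2) * ennreal \<bar>r\<bar>" for r
      by (subst ennreal_mult[symmetric]) auto
    then show "K \<theta> * ennreal (1 / 2)
        = (\<integral>\<^sup>+r. ennreal (\<bar>r\<bar> / 2) * h (p + r *\<^sub>R unit_vec (a + \<theta>)) \<partial>lborel)"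
      by (simp add: K_def nn_integral_cmult mult.assoc) (simp add: mult.commute)
  qed
  finally show ?thesis .
qed

text \<open>The measure on pairs (angle, signed radius) whose image under
  \<open>(\<theta>, r) \<mapsto> p + r *\<^sub>R unit_vec (a + \<theta>)\<close> is Lebesgue measure on the plane.\<close>

definition polar_measure :: "(real \<times> real) measure" where
  "polar_measure = density (lborel \<Otimes>\<^sub>M lborel) (\<lambda>(\<theta>, r). ennreal (indicator {0..2 * pi} \<theta> * (\<bar>r\<bar> / 2)))"

lemma lborel_polar:
  "lborel = distr polar_measure borel (\<lambda>(\<theta>, r). p + r *\<^sub>R unit_vec (a + \<theta>))"
proof (rule measure_eqI)
  fix A :: "(real^2) set" assume "A \<in> sets lborel"
  then have [measurable]: "A \<in> sets borel" by simp
  have "emeasure lborel A = (\<integral>\<^sup>+x. indicator A x \<partial>lborel)" by simp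
  also have "\<dots> = (\<integral>\<^sup>+\<theta>. \<integral>\<^sup>+r. ennreal (indicator {0..2 * pi} \<theta> * (\<bar>r\<bar> / 2)) *
      indicator A (p + r *\<^sub>R unit_vec (a + \<theta>)) \<partial>lborel \<partial>lborel)"
    by (subst nn_integral_polar[of _ p a])
       (auto intro!: nn_integral_cong split: split_indicator)
  also have "\<dots> = (\<integral>\<^sup>+x. indicator A x \<partial>distr polar_measure borel (\<lambda>(\<theta>, r). p + r *\<^sub>R unit_vec (a + \<theta>)))"
    unfolding polar_measure_def
    by (subst nn_integral_distr, measurable, subst nn_integral_density, measurable,
        subst lborel.nn_integral_fst[symmetric]) (auto simp: case_prod_beta)
  finally show "emeasure lborel A = emeasure (distr polar_measure borel (\<lambda>(\<theta>, r). p + r *\<^sub>R unit_vec (a + \<theta>))) A"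
    by simp
qed simp

lemma integral_polar:
  fixes f :: "real^2 \<Rightarrow> 'a::{banach, second_countable_topology}"
  assumes [measurable]: "f \<in> borel_measurable borel"
  shows "integrable lborel f \<longleftrightarrow> integrable (lborel \<Otimes>\<^sub>M lborel)
      (\<lambda>(\<theta>, r). (indicator {0..2 * pi} \<theta> * (\<bar>r\<bar> / 2)) *\<^sub>R f (p + r *\<^sub>R unit_vec (a + \<theta>)))"
    and "integral\<^sup>L lborel f = integral\<^sup>L (lborel \<Otimes>\<^sub>M lborel)
      (\<lambda>(\<theta>, r). (indicator {0..2 * pi} \<theta> * (\<bar>r\<bar> / 2)) *\<^sub>R f (p + r *\<^sub>R unit_vec (a + \<theta>)))"
proof -
  let ?d = "\<lambda>q::real \<times> real. indicator {0..2 * pi} (fst q) * (\<bar>snd q\<bar> / 2)"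
  let ?g = "\<lambda>q. p + snd q *\<^sub>R unit_vec (a + fst q)"
  have *: "lborel = distr (density (lborel \<Otimes>\<^sub>M lborel) (\<lambda>q. ennreal (?d q))) borel ?g"
    by (subst lborel_polar[of p a]) (simp add: polar_measure_def case_prod_beta')
  have [measurable]: "?g \<in> borel_measurable (lborel \<Otimes>\<^sub>M lborel)"
      "?d \<in> borel_measurable (lborel \<Otimes>\<^sub>M lborel)"
    by measurable
  have "integrable lborel f \<longleftrightarrow> integrable (lborel \<Otimes>\<^sub>M lborel) (\<lambda>q. ?d q *\<^sub>R f (?g q))"
    by (subst *) (simp add: integrable_distr_eq integrable_density)
  then show "integrable lborel f \<longleftrightarrow> integrable (lborel \<Otimes>\<^sub>M lborel)
      (\<lambda>(\<theta>, r). (indicator {0..2 * pi} \<theta> * (\<bar>r\<bar> / 2)) *\<^sub>R f (p + r *\<^sub>R unit_vec (a + \<theta>)))"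
    by (simp add: case_prod_beta')
  have "integral\<^sup>L lborel f = integral\<^sup>L (lborel \<Otimes>\<^sub>M lborel) (\<lambda>q. ?d q *\<^sub>R f (?g q))"
    by (subst *) (simp add: integral_distr integral_density)
  then show "integral\<^sup>L lborel f = integral\<^sup>L (lborel \<Otimes>\<^sub>M lborel)
      (\<lambda>(\<theta>, r). (indicator {0..2 * pi} \<theta> * (\<bar>r\<bar> / 2)) *\<^sub>R f (p + r *\<^sub>R unit_vec (a + \<theta>)))"
    by (simp add: case_prod_beta')
qed

section \<open>Schwartz functions and their Fourier transforms\<close>

lemma schwartz_differentiable: "f \<in> schwartz_space \<Longrightarrow> f differentiable (at x)"
  unfolding schwartz_space_def by (auto dest: spec[of _ "[]"])

lemma schwartz_partial_deriv:
  assumes "f \<in> schwartz_space"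
  shows "partial_deriv i f \<in> schwartz_space"
  unfolding schwartz_space_def
proof (intro CollectI allI)
  fix js
  have "fold partial_deriv js (partial_deriv i f) = fold partial_deriv (i # js) f"
    by simp
  then show "(\<forall>x. fold partial_deriv js (partial_deriv i f) differentiable at x) \<and>
      (\<forall>k. bounded (range (\<lambda>x. norm x ^ k *\<^sub>R fold partial_deriv js (partial_deriv i f) x)))"
    using assms unfolding schwartz_space_def by (simp only: mem_Collect_eq) blast
qed

lemma schwartz_continuous: "f \<in> schwartz_space \<Longrightarrow> continuous_on S f"
  by (intro differentiable_imp_continuous_on)
    (auto simp: differentiable_on_def intro: differentiable_at_withinI schwartz_differentiable)

lemma schwartz_measurable: "f \<in> schwartz_space \<Longrightarrow> f \<in> borel_measurable borel"
  by (intro borel_measurable_continuous_onI schwartz_continuous)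

lemma schwartz_decay:
  assumes "f \<in> schwartz_space"
  obtains C where "C \<ge> 0" "\<And>x. norm (f x) \<le> C * (1 / (1 + (norm x)\<^sup>2)\<^sup>2)"
proof -
  have "bounded (range (\<lambda>x. norm x ^ k *\<^sub>R f x))" for k
    using assms unfolding schwartz_space_def by (auto dest: spec[of _ "[]"])
  then have "\<exists>C. \<forall>x. norm x ^ k * norm (f x) \<le> C" for k
    unfolding bounded_iff by simp
  then obtain C where C: "norm x ^ k * norm (f x) \<le> C k" for k x
    by metis
  have "norm (f x) \<le> (C 0 + 2 * C 2 + C 4) * (1 / (1 + (norm x)\<^sup>2)\<^sup>2)" for x
  proof -
    have "norm (f x) * (1 + (norm x)\<^sup>2)\<^sup>2
        = norm x ^ 0 * norm (f x) + 2 * (norm x ^ 2 * norm (f x)) + norm x ^ 4 * norm (f x)"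
      by (simp add: power2_eq_square power4_eq_xxxx algebra_simps)
    also have "\<dots> \<le> C 0 + 2 * C 2 + C 4"
      by (intro add_mono mult_left_mono C) simp
    finally have "norm (f x) * (1 + (norm x)\<^sup>2)\<^sup>2 \<le> C 0 + 2 * C 2 + C 4" .
    moreover have "(1 + (norm x)\<^sup>2)\<^sup>2 > 0"
      by (intro zero_less_power add_pos_nonneg) auto
    ultimately show ?thesis
      by (simp add: pos_le_divide_eq)
  qed
  moreover have "0 \<le> C 0 + 2 * C 2 + C 4"
  proof -
    have "norm (f 0) \<le> C 0" "0 \<le> C 2" "0 \<le> C 4"
      using C[of 0 0] C[of 0 2] C[of 0 4] by simp_all
    then show ?thesis using norm_ge_zero[of "f 0"] by linarith
  qed
  ultimately show ?thesis by (rule that[rotated])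
qed

lemma integrable_inverse_1_plus_square_real:
  "integrable lborel (\<lambda>x::real. 1 / (1 + x\<^sup>2))"
  using integrable_inverse_1_plus_square by (simp add: set_integrable_def inverse_eq_divide)

lemma norm_frame:
  "(norm (s *\<^sub>R unit_vec a + t *\<^sub>R unit_vec (a + pi / 2)))\<^sup>2 = s\<^sup>2 + t\<^sup>2"
  unfolding power2_norm_eq_inner
  by (simp add: inner_add_left inner_add_right inner_unit_vec power2_eq_square)

lemma decay_le_product:
  "1 / (1 + (norm (s *\<^sub>R unit_vec a + t *\<^sub>R unit_vec (a + pi / 2)))\<^sup>2)\<^sup>2
    \<le> 1 / (1 + s\<^sup>2) * (1 / (1 + t\<^sup>2))"
proof -
  have "(1 + s\<^sup>2) * (1 + t\<^sup>2) \<le> (1 + (s\<^sup>2 + t\<^sup>2))\<^sup>2"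
  proof -
    have "(1 + (s\<^sup>2 + t\<^sup>2))\<^sup>2 - (1 + s\<^sup>2) * (1 + t\<^sup>2) = s\<^sup>2 + t\<^sup>2 + s^4 + t^4 + s\<^sup>2 * t\<^sup>2"
      by (simp add: power2_eq_square power4_eq_xxxx algebra_simps)
    moreover have "\<dots> \<ge> 0" by simp
    ultimately show ?thesis by linarith
  qed
  moreover have "(1 + s\<^sup>2) * (1 + t\<^sup>2) > 0"
    by (intro mult_pos_pos add_pos_nonneg) auto
  ultimately have "1 / (1 + (s\<^sup>2 + t\<^sup>2))\<^sup>2 \<le> 1 / ((1 + s\<^sup>2) * (1 + t\<^sup>2))"
    by (intro frac_le) auto
  then show ?thesis by (simp add: norm_frame)
qed

lemma integrable_lborel_product:
  fixes f g :: "real \<Rightarrow> 'a::{real_normed_field, banach, second_countable_topology}"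
  assumes f: "integrable lborel f" and g: "integrable lborel g"
  shows "integrable (lborel \<Otimes>\<^sub>M lborel) (\<lambda>(x, y). f x * g y)"
proof (rule lborel_pair.Fubini_integrable)
  have [measurable]: "f \<in> borel_measurable borel" "g \<in> borel_measurable borel"
    using f g by auto
  show "(\<lambda>(x, y). f x * g y) \<in> borel_measurable (lborel \<Otimes>\<^sub>M lborel)"
    by measurable
  show "integrable lborel (\<lambda>x. LINT y|lborel. norm (case (x, y) of (x, y) \<Rightarrow> f x * g y))"
    using f by (simp add: norm_mult)
  show "AE x in lborel. integrable lborel (\<lambda>y. case (x, y) of (x, y) \<Rightarrow> f x * g y)"
    using g by simp
qed

lemma integrable_product_decay:
  "integrable (lborel \<Otimes>\<^sub>M lborel) (\<lambda>(s::real, t::real). 1 / (1 + s\<^sup>2) * (1 / (1 + t\<^sup>2)))"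
  by (intro integrable_lborel_product integrable_inverse_1_plus_square_real)

lemma integrable_decay: "integrable lborel (\<lambda>x::real^2. 1 / (1 + (norm x)\<^sup>2)\<^sup>2)"
proof -
  have "integrable (lborel \<Otimes>\<^sub>M lborel) (\<lambda>q. 1 / (1 + (norm (0 + fst q *\<^sub>R unit_vec 0 + snd q *\<^sub>R unit_vec (0 + pi / 2)))\<^sup>2)\<^sup>2)"
  proof (rule Bochner_Integration.integrable_bound[OF integrable_product_decay])
    show "AE q in lborel \<Otimes>\<^sub>M lborel.
       norm (1 / (1 + (norm (0 + fst q *\<^sub>R unit_vec 0 + snd q *\<^sub>R unit_vec (0 + pi / 2)))\<^sup>2)\<^sup>2)
       \<le> norm (case q of (s, t) \<Rightarrow> 1 / (1 + s\<^sup>2) * (1 / (1 + t\<^sup>2)))"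
      using decay_le_product[of _ 0] by (intro AE_I2) (auto simp: case_prod_beta)
  qed measurable
  then show ?thesis
    by (subst lborel_frame[of 0 0]) (simp add: integrable_distr_eq case_prod_beta')
qed

lemma schwartz_integrable:
  assumes f: "f \<in> schwartz_space"
  shows "integrable lborel f"
proof -
  obtain C where "\<And>x. norm (f x) \<le> C * (1 / (1 + (norm x)\<^sup>2)\<^sup>2)"
    using schwartz_decay[OF f] by metis
  moreover have "integrable lborel (\<lambda>x::real^2. C * (1 / (1 + (norm x)\<^sup>2)\<^sup>2))"
    by (intro integrable_mult_right integrable_decay)
  ultimately show ?thesis
    using schwartz_measurable[OF f]
    by (elim Bochner_Integration.integrable_bound) (auto intro!: AE_I2 order_trans[OF _ abs_ge_self]
      simp del: times_divide_eq_right mult_1_right)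
qed

lemma norm_exp_neg_ii [simp]: "norm (exp (- \<i> * complex_of_real x)) = 1"
  using norm_exp_i_times[of "- x"] by simp

lemma has_vector_derivative_quotient:
  assumes "(F has_vector_derivative v) (at 0)"
  shows "((\<lambda>t. (F t - F 0) /\<^sub>R t) \<longlongrightarrow> v) (at 0)"
proof -
  have "((\<lambda>t. (F t - F 0 - t *\<^sub>R v) /\<^sub>R norm t) \<longlongrightarrow> 0) (at 0)"
    using assms by (simp add: has_vector_derivative_def has_derivative_at_within)
  then have "((\<lambda>t. norm ((F t - F 0 - t *\<^sub>R v) /\<^sub>R norm t)) \<longlongrightarrow> 0) (at 0)"
    by (rule tendsto_norm_zero)
  moreover have "eventually (\<lambda>t. norm ((F t - F 0 - t *\<^sub>R v) /\<^sub>R norm t) = norm ((F t - F 0) /\<^sub>R t - v)) (at 0)"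
  proof -
    have "norm ((F t - F 0 - t *\<^sub>R v) /\<^sub>R norm t) = norm ((F t - F 0) /\<^sub>R t - v)" if "t \<noteq> 0" for t :: real
    proof -
      have "(F t - F 0) /\<^sub>R t - v = (F t - F 0 - t *\<^sub>R v) /\<^sub>R t"
        using that by (simp add: scaleR_diff_right)
      then show ?thesis by simp
    qed
    then show ?thesis by (auto simp: eventually_at_filter)
  qed
  ultimately have "((\<lambda>t. norm ((F t - F 0) /\<^sub>R t - v)) \<longlongrightarrow> 0) (at 0)"
    by (rule Lim_transform_eventually)
  then show ?thesis
    by (simp add: tendsto_norm_zero_iff LIM_zero_iff)
qed

lemma schwartz_line_deriv:
  assumes f: "f \<in> schwartz_space"
  shows "((\<lambda>t. f (x + t *\<^sub>R axis i 1)) has_vector_derivative partial_deriv i f (x + t *\<^sub>R axis i 1)) (at t)"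
proof -
  have D: "(f has_derivative frechet_derivative f (at (x + t *\<^sub>R axis i 1))) (at (x + t *\<^sub>R axis i 1))"
    using schwartz_differentiable[OF f] by (simp add: frechet_derivative_works)
  have "((\<lambda>t. x + t *\<^sub>R axis i 1) has_derivative (\<lambda>h. h *\<^sub>R axis i 1)) (at t)"
    by (auto intro!: derivative_eq_intros)
  from has_derivative_compose[OF this D] show ?thesis
    using linear_frechet_derivative[OF schwartz_differentiable[OF f]]
    by (simp add: has_vector_derivative_def partial_deriv_def linear_scale)
qed

text \<open>Instead of integrating by parts, the translation \<open>x \<mapsto> x + h e\<close> is moved from the difference
  quotient of \<open>f\<close> onto the exponential, and \<open>h\<close> tends to \<open>0\<close> under dominated convergence.\<close>

lemma fourier2_partial_deriv:
  assumes f: "f \<in> schwartz_space"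
  shows "fourier2 (partial_deriv i f) \<omega> = \<i> * of_real (\<omega> $ i) * fourier2 f \<omega>"
proof -
  define e where "e = (axis i 1 :: real^2)"
  define h where "h n = inverse (real (Suc n))" for n
  define E where "E x = exp (- \<i> * complex_of_real (x \<bullet> \<omega>))" for x
  have h: "h n > 0" "h n \<le> 1" for n
    by (auto simp: h_def field_simps)
  have h0: "filterlim h (at 0) sequentially"
  proof -
    have "h \<longlonglongrightarrow> 0" unfolding h_def by (rule LIMSEQ_inverse_real_of_nat)
    then show ?thesis using h by (auto simp: filterlim_at intro!: always_eventually less_imp_neq[symmetric])
  qed
  note [measurable] = schwartz_measurable[OF f] schwartz_measurable[OF schwartz_partial_deriv[OF f, of i]]
  have [measurable]: "E \<in> borel_measurable borel"
    unfolding E_def by measurable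
  have normE: "norm (E x) = 1" for x by (simp add: E_def del: mult_minus_left)
  have Eadd: "E (x + y) = E x * E y" for x y
    by (simp add: E_def inner_add_left algebra_simps flip: exp_add)
  have intE: "integrable lborel (\<lambda>x. f x * E x)"
    by (rule Bochner_Integration.integrable_bound[OF schwartz_integrable[OF f]])
      (auto simp: norm_mult normE)
  have shift: "integrable lborel (\<lambda>x. f (x + c) * E x) \<and>
      (LINT x|lborel. f (x + c) * E x) = E (- c) * (LINT x|lborel. f x * E x)" for c
  proof -
    have 1: "f (x + c) * E x = E (- c) * (f (c + x) * E (c + x))" for x
      using Eadd[of "c + x" "- c"] by (simp add: ac_simps)
    have "integrable (distr lborel borel ((+) c)) (\<lambda>x. f x * E x)"
      using intE by (simp add: lborel_distr_plus)
    then have "integrable lborel (\<lambda>x. f (c + x) * E (c + x))"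
      by (subst (asm) integrable_distr_eq) auto
    moreover have "(LINT x|lborel. f (c + x) * E (c + x)) = (LINT x|distr lborel borel ((+) c). f x * E x)"
      by (subst integral_distr) auto
    ultimately show ?thesis
      unfolding 1 by (simp add: lborel_distr_plus)
  qed
  let ?q = "\<lambda>n x. (f (x + h n *\<^sub>R e) * E x - f x * E x) / of_real (h n)"
  obtain C where C: "C \<ge> 0" "\<And>x. norm (partial_deriv i f x) \<le> C * (1 / (1 + (norm x)\<^sup>2)\<^sup>2)"
    using schwartz_decay[OF schwartz_partial_deriv[OF f]] by metis
  \<comment> \<open>By the mean value theorem the quotient is bounded by the derivative at a point within distance \<open>1\<close>,
    where the decay bound is at most \<open>16\<close> times larger.\<close>
  have bound: "norm (?q n x) \<le> 16 * C * (1 / (1 + (norm x)\<^sup>2)\<^sup>2)" for n x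
  proof -
    have "\<exists>t\<in>{0<..<h n}. norm (f (x + h n *\<^sub>R e) - f (x + 0 *\<^sub>R e))
        \<le> norm ((h n - 0) *\<^sub>R partial_deriv i f (x + t *\<^sub>R e))"
    proof (rule mvt_general[OF h(1)])
      show "continuous_on {0..h n} (\<lambda>t. f (x + t *\<^sub>R e))"
        using schwartz_line_deriv[OF f, of x i] unfolding e_def
        by (intro continuous_at_imp_continuous_on ballI has_vector_derivative_continuous)
      show "((\<lambda>t. f (x + t *\<^sub>R e)) has_derivative (\<lambda>s. s *\<^sub>R partial_deriv i f (x + t *\<^sub>R e))) (at t)" for t
        using schwartz_line_deriv[OF f, of x i t] unfolding e_def by (simp add: has_vector_derivative_def)
    qed
    then obtain t where t: "0 < t" "t < h n"
        and le: "norm (f (x + h n *\<^sub>R e) - f x) \<le> h n * norm (partial_deriv i f (x + t *\<^sub>R e))"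
      using h(1)[of n] by auto
    define y where "y = x + t *\<^sub>R e"
    have "norm x \<le> norm y + norm (t *\<^sub>R e)"
      unfolding y_def using norm_triangle_ineq4[of "x + t *\<^sub>R e" "t *\<^sub>R e"] by simp
    also have "norm (t *\<^sub>R e) \<le> 1"
      using t h(2)[of n] by (simp add: e_def norm_axis_1)
    finally have "(norm x)\<^sup>2 \<le> (norm y + 1)\<^sup>2"
      by (intro power_mono) auto
    also have "\<dots> \<le> 2 * (norm y)\<^sup>2 + 2"
      using zero_le_power2[of "norm y - 1"] unfolding power2_sum power2_diff by simp
    finally have "1 + (norm x)\<^sup>2 \<le> 4 * (1 + (norm y)\<^sup>2)"
      using zero_le_power2[of "norm y"] unfolding distrib_left by linarith
    then have "(1 + (norm x)\<^sup>2)\<^sup>2 \<le> (4 * (1 + (norm y)\<^sup>2))\<^sup>2"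
      by (intro power_mono) auto
    also have "\<dots> = 16 * (1 + (norm y)\<^sup>2)\<^sup>2"
      unfolding power_mult_distrib by simp
    finally have dec: "(1 + (norm x)\<^sup>2)\<^sup>2 \<le> 16 * (1 + (norm y)\<^sup>2)\<^sup>2" .
    have pos: "(1 + (norm z)\<^sup>2)\<^sup>2 > 0" for z :: "real^2"
      by (intro zero_less_power add_pos_nonneg) auto
    have "?q n x = (f (x + h n *\<^sub>R e) - f x) * E x / of_real (h n)"
      by (simp add: algebra_simps)
    then have "norm (?q n x) = norm (f (x + h n *\<^sub>R e) - f x) / h n"
      using h(1)[of n] by (simp add: norm_divide norm_mult normE)
    also have "\<dots> \<le> norm (partial_deriv i f y)"
      using le h(1)[of n] unfolding y_def by (simp add: pos_divide_le_eq mult.commute)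
    also have "\<dots> \<le> C * (1 / (1 + (norm y)\<^sup>2)\<^sup>2)"
      by (rule C)
    also have "\<dots> \<le> C * (16 * (1 / (1 + (norm x)\<^sup>2)\<^sup>2))"
      using dec pos[of x] pos[of y] C(1) by (intro mult_left_mono) (auto simp: field_simps)
    finally show ?thesis by (simp add: mult.commute)
  qed
  have "(\<lambda>n. LINT x|lborel. ?q n x) \<longlonglongrightarrow> (LINT x|lborel. partial_deriv i f x * E x)"
  proof (rule integral_dominated_convergence[where w = "\<lambda>x. 16 * C * (1 / (1 + (norm x)\<^sup>2)\<^sup>2)"])
    show "integrable lborel (\<lambda>x::real^2. 16 * C * (1 / (1 + (norm x)\<^sup>2)\<^sup>2))"
      by (intro integrable_mult_right integrable_decay)
    show "AE x in lborel. (\<lambda>n. ?q n x) \<longlonglongrightarrow> partial_deriv i f x * E x"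
    proof (rule AE_I2)
      fix x
      have "((\<lambda>t. f (x + t *\<^sub>R e)) has_vector_derivative partial_deriv i f x) (at 0)"
        using schwartz_line_deriv[OF f, of x i 0] by (simp add: e_def)
      from has_vector_derivative_quotient[OF this]
      have "((\<lambda>t. (f (x + t *\<^sub>R e) - f x) /\<^sub>R t) \<longlongrightarrow> partial_deriv i f x) (at 0)"
        by simp
      from tendsto_mult[OF filterlim_compose[OF this h0] tendsto_const[of "E x"]]
      show "(\<lambda>n. ?q n x) \<longlonglongrightarrow> partial_deriv i f x * E x"
        by (simp add: scaleR_conv_of_real divide_inverse algebra_simps)
    qed
    show "AE x in lborel. norm (?q n x) \<le> 16 * C * (1 / (1 + (norm x)\<^sup>2)\<^sup>2)" for n
      using bound by (intro AE_I2)
  qed measurable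
  moreover have "(\<lambda>n. LINT x|lborel. ?q n x) \<longlonglongrightarrow> \<i> * of_real (\<omega> $ i) * (LINT x|lborel. f x * E x)"
  proof -
    have 1: "(LINT x|lborel. ?q n x) = (E (- (h n *\<^sub>R e)) - 1) /\<^sub>R h n * (LINT x|lborel. f x * E x)" for n
    proof -
      have "(LINT x|lborel. ?q n x)
          = ((LINT x|lborel. f (x + h n *\<^sub>R e) * E x) - (LINT x|lborel. f x * E x)) / of_real (h n)"
        using shift[of "h n *\<^sub>R e"] intE by simp
      also have "(LINT x|lborel. f (x + h n *\<^sub>R e) * E x) = E (- (h n *\<^sub>R e)) * (LINT x|lborel. f x * E x)"
        using shift[of "h n *\<^sub>R e"] by simp
      finally show ?thesis
        by (simp only: scaleR_conv_of_real[where 'a = complex] of_real_inverse divide_inverse)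
          (simp add: algebra_simps)
    qed
    have 2: "E (- (t *\<^sub>R e)) = exp (of_real t * (\<i> * of_real (\<omega> $ i)))" for t
      by (simp add: E_def e_def inner_axis' mult_ac)
    have "((\<lambda>t. exp (of_real t * (\<i> * of_real (\<omega> $ i)))) has_vector_derivative \<i> * of_real (\<omega> $ i)) (at 0)"
      using exp_scaleR_has_vector_derivative_right[of "\<i> * of_real (\<omega> $ i)" 0 UNIV]
      by (simp add: scaleR_conv_of_real)
    from has_vector_derivative_quotient[OF this]
    have "((\<lambda>t. (E (- (t *\<^sub>R e)) - 1) /\<^sub>R t) \<longlongrightarrow> \<i> * of_real (\<omega> $ i)) (at 0)"
      unfolding 2 by simp
    from tendsto_mult[OF filterlim_compose[OF this h0] tendsto_const]
    show ?thesis unfolding 1 .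
  qed
  ultimately have "(LINT x|lborel. partial_deriv i f x * E x) = \<i> * of_real (\<omega> $ i) * (LINT x|lborel. f x * E x)"
    by (rule LIMSEQ_unique)
  then show ?thesis
    by (simp add: fourier2_def E_def)
qed

lemma fourier2_measurable:
  assumes f: "f \<in> schwartz_space"
  shows "fourier2 f \<in> borel_measurable borel"
proof -
  note [measurable] = schwartz_measurable[OF f]
  show ?thesis unfolding fourier2_def by measurable
qed

text \<open>Two derivatives suffice for decay of order \<open>1 / (norm x)\<^sup>2\<close>, which makes the transform
  integrable along every line.\<close>

lemma fourier2_decay:
  assumes f: "f \<in> schwartz_space"
  obtains C where "C \<ge> 0" "\<And>x. norm (fourier2 f x) \<le> C * (1 / (1 + (norm x)\<^sup>2))"
proof -
  define B where "B g = 1 / (2 * pi) * (LINT x|lborel. norm (g x))" for g :: "real^2 \<Rightarrow> complex"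
  have B: "norm (fourier2 g x) \<le> B g" for g x
  proof -
    have "norm (fourier2 g x) = 1 / (2 * pi) * norm (LINT y|lborel. g y * exp (- \<i> * of_real (y \<bullet> x)))"
      by (simp add: fourier2_def norm_mult norm_divide)
    also have "\<dots> \<le> 1 / (2 * pi) * (LINT y|lborel. norm (g y * exp (- \<i> * of_real (y \<bullet> x))))"
      by (intro mult_left_mono integral_norm_bound) auto
    finally show ?thesis by (simp add: B_def norm_mult del: mult_minus_left)
  qed
  have sq: "(x $ i)\<^sup>2 * norm (fourier2 f x) \<le> B (partial_deriv i (partial_deriv i f))" for x i
  proof -
    have "fourier2 (partial_deriv i (partial_deriv i f)) x = - of_real ((x $ i)\<^sup>2) * fourier2 f x"
      by (simp add: fourier2_partial_deriv f schwartz_partial_deriv power2_eq_square algebra_simps)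
    then have "norm (fourier2 (partial_deriv i (partial_deriv i f)) x) = (x $ i)\<^sup>2 * norm (fourier2 f x)"
      by (simp add: norm_mult norm_power)
    then show ?thesis using B by metis
  qed
  define C where "C = B f + B (partial_deriv 1 (partial_deriv 1 f)) + B (partial_deriv 2 (partial_deriv 2 f))"
  have "norm (fourier2 f x) \<le> C * (1 / (1 + (norm x)\<^sup>2))" for x
  proof -
    have "(norm x)\<^sup>2 = (x $ 1)\<^sup>2 + (x $ 2)\<^sup>2"
      unfolding power2_norm_eq_inner by (simp add: inner_vec_def sum_2 power2_eq_square)
    then have "norm (fourier2 f x) * (1 + (norm x)\<^sup>2) \<le> C"
      using B[of f x] sq[of x 1] sq[of x 2] by (simp add: C_def algebra_simps)
    moreover have "1 + (norm x)\<^sup>2 > 0" by (intro add_pos_nonneg) auto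
    ultimately show ?thesis by (simp add: pos_le_divide_eq)
  qed
  moreover have "C \<ge> 0"
    unfolding C_def B_def by (intro add_nonneg_nonneg mult_nonneg_nonneg integral_nonneg_AE) auto
  ultimately show ?thesis by (rule that[rotated])
qed

section \<open>The projection slice theorem\<close>

lemma fourier2_line_decay:
  assumes f: "f \<in> schwartz_space"
  obtains C where "C \<ge> 0"
    "\<And>p u r. norm u = 1 \<Longrightarrow> norm (fourier2 f (p + r *\<^sub>R u)) \<le> C * (2 + 2 * (norm p)\<^sup>2) * (1 / (1 + r\<^sup>2))"
proof -
  obtain C where C: "C \<ge> 0" "\<And>x. norm (fourier2 f x) \<le> C * (1 / (1 + (norm x)\<^sup>2))"
    using fourier2_decay[OF f] by metis
  have "norm (fourier2 f (p + r *\<^sub>R u)) \<le> C * (2 + 2 * (norm p)\<^sup>2) * (1 / (1 + r\<^sup>2))"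
    if u: "norm u = 1" for p u :: "real^2" and r :: real
  proof -
    define x where "x = p + r *\<^sub>R u"
    have "\<bar>r\<bar> = norm (x - p)" using u by (simp add: x_def)
    also have "\<dots> \<le> norm x + norm p" by (rule norm_triangle_ineq4)
    finally have "\<bar>r\<bar>\<^sup>2 \<le> (norm x + norm p)\<^sup>2" by (intro power_mono) auto
    also have "\<dots> \<le> 2 * (norm x)\<^sup>2 + 2 * (norm p)\<^sup>2"
      using zero_le_power2[of "norm x - norm p"] unfolding power2_sum power2_diff by simp
    finally have "1 + r\<^sup>2 \<le> 1 + 2 * (norm x)\<^sup>2 + 2 * (norm p)\<^sup>2" by simp
    also have "\<dots> \<le> (2 + 2 * (norm p)\<^sup>2) * (1 + (norm x)\<^sup>2)"
      using zero_le_power2[of "norm p * norm x"] by (simp add: algebra_simps power_mult_distrib)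
    finally have le: "1 + r\<^sup>2 \<le> (2 + 2 * (norm p)\<^sup>2) * (1 + (norm x)\<^sup>2)" .
    have "1 + r\<^sup>2 > 0" "1 + (norm x)\<^sup>2 > 0" by (intro add_pos_nonneg; simp)+
    then have "1 / (1 + (norm x)\<^sup>2) \<le> (2 + 2 * (norm p)\<^sup>2) * (1 / (1 + r\<^sup>2))"
      using le by (simp add: field_simps)
    then have "C * (1 / (1 + (norm x)\<^sup>2)) \<le> C * ((2 + 2 * (norm p)\<^sup>2) * (1 / (1 + r\<^sup>2)))"
      using C(1) by (rule mult_left_mono)
    then show ?thesis using C(2)[of x] by (simp add: x_def mult.assoc)
  qed
  with C(1) show ?thesis by (rule that)
qed

lemma fourier2_line_integrable:
  assumes f: "f \<in> schwartz_space" and u: "norm u = 1"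
  shows "integrable lborel (\<lambda>r. fourier2 f (p + r *\<^sub>R u))"
proof -
  obtain C where "\<And>r. norm (fourier2 f (p + r *\<^sub>R u)) \<le> C * (2 + 2 * (norm p)\<^sup>2) * (1 / (1 + r\<^sup>2))"
    using fourier2_line_decay[OF f] u by metis
  moreover have "integrable lborel (\<lambda>r. C * (2 + 2 * (norm p)\<^sup>2) * (1 / (1 + r\<^sup>2)))"
    by (intro integrable_mult_right integrable_inverse_1_plus_square_real)
  moreover have "(\<lambda>r. fourier2 f (p + r *\<^sub>R u)) \<in> borel_measurable lborel"
    using fourier2_measurable[OF f] by measurable
  ultimately show ?thesis
    by (elim Bochner_Integration.integrable_bound) (auto intro!: AE_I2 order_trans[OF _ abs_ge_self]
      simp del: times_divide_eq_right mult_1_right)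
qed

lemma std_normal_fourier:
  "(LINT s|lborel. of_real (std_normal_density s) * exp (- \<i> * of_real (s * \<eta>)))
    = complex_of_real (exp (- \<eta>\<^sup>2 / 2))"
proof -
  have "complex_of_real (exp (- (- \<eta>)\<^sup>2 / 2)) = char std_normal_distribution (- \<eta>)"
    by (simp add: char_std_normal_distribution)
  also have "\<dots> = (LINT s|lborel. std_normal_density s *\<^sub>R iexp (- \<eta> * s))"
    unfolding char_def by (subst integral_density) (auto simp: normal_density_nonneg)
  also have "\<dots> = (LINT s|lborel. of_real (std_normal_density s) * exp (- \<i> * of_real (s * \<eta>)))"
    by (simp add: scaleR_conv_of_real mult_ac)
  finally show ?thesis by simp
qed

lemma std_normal_fourier_scaled:
  assumes "k > 0"
  shows "(LINT r|lborel. of_real (sqrt (2 * pi) * std_normal_density (k * r)) * exp (- \<i> * of_real (r * \<eta>)))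
    = complex_of_real (2 * pi / k * std_normal_density (\<eta> / k))"
proof -
  have "(LINT r|lborel. of_real (sqrt (2 * pi) * std_normal_density (k * r)) * exp (- \<i> * of_real (r * \<eta>)))
    = \<bar>1 / k\<bar> *\<^sub>R (LINT s|lborel. of_real (sqrt (2 * pi) * std_normal_density (k * (0 + 1 / k * s)))
        * exp (- \<i> * of_real ((0 + 1 / k * s) * \<eta>)))"
    using assms by (intro lborel_integral_real_affine) auto
  also have "(\<lambda>s. of_real (sqrt (2 * pi) * std_normal_density (k * (0 + 1 / k * s)))
        * exp (- \<i> * of_real ((0 + 1 / k * s) * \<eta>)))
      = (\<lambda>s. of_real (sqrt (2 * pi)) * (of_real (std_normal_density s) * exp (- \<i> * of_real (s * (\<eta> / k)))))"
    using assms by (simp add: mult.assoc)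
  also have "\<bar>1 / k\<bar> *\<^sub>R (LINT s|lborel. of_real (sqrt (2 * pi)) * (of_real (std_normal_density s) * exp (- \<i> * of_real (s * (\<eta> / k)))))
      = \<bar>1 / k\<bar> *\<^sub>R (of_real (sqrt (2 * pi)) * complex_of_real (exp (- (\<eta> / k)\<^sup>2 / 2)))"
    by (subst integral_mult_right_zero) (simp only: std_normal_fourier)
  also have "\<dots> = complex_of_real (1 / k * (sqrt (2 * pi) * exp (- (\<eta> / k)\<^sup>2 / 2)))"
    using assms by (simp add: scaleR_conv_of_real)
  also have "1 / k * (sqrt (2 * pi) * exp (- (\<eta> / k)\<^sup>2 / 2)) = 2 * pi / k * std_normal_density (\<eta> / k)"
  proof -
    have "2 * pi / k * std_normal_density (\<eta> / k)
        = 2 * pi / sqrt (2 * pi) * (exp (- (\<eta> / k)\<^sup>2 / 2) / k)"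
      by (simp add: normal_density_def ac_simps del: real_div_sqrt)
    also have "2 * pi / sqrt (2 * pi) = sqrt (2 * pi)"
      by (rule real_div_sqrt) simp
    finally have "2 * pi / k * std_normal_density (\<eta> / k) = sqrt (2 * pi) * (exp (- (\<eta> / k)\<^sup>2 / 2) / k)" .
    then show ?thesis by (simp only:) simp
  qed
  finally show ?thesis .
qed

lemma std_normal_density_bound: "std_normal_density x \<le> 1"
proof -
  have "sqrt 1 \<le> sqrt (2 * pi)" using pi_gt3 by (intro real_sqrt_le_mono) simp
  then show ?thesis
    using mult_mono[of "1 / sqrt (2 * pi)" 1 "exp (- x\<^sup>2 / 2)" 1] by (simp add: normal_density_def)
qed

text \<open>The integral of the Fourier transform along a line is the one-dimensional Fourier
  transform of the slice of \<open>f\<close> through the origin orthogonal to it. The line integral is regularized by the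
  Gaussian \<open>exp (- (k r)\<^sup>2 / 2)\<close>; by Fubini this becomes an average of the slices of \<open>f\<close> at distance \<open>k t\<close>
  from the origin with \<open>t\<close> normally distributed, and \<open>k \<longlonglongrightarrow> 0\<close>.\<close>

theorem projection_slice:
  assumes f: "f \<in> schwartz_space"
  shows "(LINT r|lborel. fourier2 f (p + r *\<^sub>R unit_vec (a + pi / 2)))
    = (LINT s|lborel. f (s *\<^sub>R unit_vec a) * exp (- \<i> * of_real (s * (p \<bullet> unit_vec a))))"
proof -
  define e where "e = unit_vec a"
  define e' where "e' = unit_vec (a + pi / 2)"
  define k where "k n = inverse (real (Suc n))" for n
  define E where "E y = exp (- \<i> * complex_of_real (p \<bullet> y))" for y
  define \<Psi> where "\<Psi> t = (LINT s|lborel. f (s *\<^sub>R e + t *\<^sub>R e') * E (s *\<^sub>R e + t *\<^sub>R e'))" for t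
  let ?N = std_normal_density
  let ?G = "\<lambda>n r. sqrt (2 * pi) * ?N (k n * r)"
  note [measurable] = schwartz_measurable[OF f] fourier2_measurable[OF f]
  have contE: "continuous_on S E" for S
    unfolding E_def by (intro continuous_intros)
  then have [measurable]: "E \<in> borel_measurable borel"
    by (intro borel_measurable_continuous_onI)
  have normE: "norm (E y) = 1" for y by (simp add: E_def del: mult_minus_left)
  have k: "k n > 0" for n by (simp add: k_def)
  have k0: "k \<longlonglongrightarrow> 0" unfolding k_def by (rule LIMSEQ_inverse_real_of_nat)
  have inner: "(s *\<^sub>R e + t *\<^sub>R e') \<bullet> e' = t" for s t
    by (simp add: e_def e'_def inner_add_left inner_unit_vec)
  \<comment> \<open>The regularized line integral, with \<open>k n\<close> in place of \<open>k\<close>.\<close>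
  define A where "A n = (LINT r|lborel. of_real (?G n r) * fourier2 f (p + r *\<^sub>R e'))" for n
  obtain C where C: "C \<ge> 0" "\<And>x. norm (f x) \<le> C * (1 / (1 + (norm x)\<^sup>2)\<^sup>2)"
    using schwartz_decay[OF f] by metis
  have bnd: "norm (f (s *\<^sub>R e + t *\<^sub>R e') * E (s *\<^sub>R e + t *\<^sub>R e')) \<le> C * (1 / (1 + s\<^sup>2))" for s t
  proof -
    have "norm (f (s *\<^sub>R e + t *\<^sub>R e')) \<le> C * (1 / (1 + s\<^sup>2) * (1 / (1 + t\<^sup>2)))"
      using C(2)[of "s *\<^sub>R e + t *\<^sub>R e'"] mult_left_mono[OF decay_le_product[of s a t] C(1)]
      unfolding e_def e'_def by linarith
    also have "\<dots> \<le> C * (1 / (1 + s\<^sup>2) * 1)"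
      using C(1) by (intro mult_left_mono) (auto simp: divide_le_eq_1 add_pos_nonneg)
    finally show ?thesis by (simp add: norm_mult normE)
  qed
  have intC: "integrable lborel (\<lambda>s::real. C * (1 / (1 + s\<^sup>2)))"
    by (intro integrable_mult_right integrable_inverse_1_plus_square_real)
  have \<Psi>_bound: "norm (\<Psi> t) \<le> (LINT s|lborel. C * (1 / (1 + s\<^sup>2)))" for t
    unfolding \<Psi>_def
    by (rule Bochner_Integration.integral_norm_bound_integral[OF _ intC])
      (use bnd in \<open>auto intro!: Bochner_Integration.integrable_bound[OF intC] AE_I2 order_trans[OF _ abs_ge_self]
        simp del: times_divide_eq_right mult_1_right\<close>)
  have [measurable]: "\<Psi> \<in> borel_measurable borel"
    unfolding \<Psi>_def by measurable
  have \<Psi>_lim: "(\<lambda>n. \<Psi> (k n * t)) \<longlonglongrightarrow> \<Psi> 0" for t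
    unfolding \<Psi>_def
  proof (rule integral_dominated_convergence[OF _ _ intC])
    have "(\<lambda>n. k n * t) \<longlonglongrightarrow> 0 * t" by (intro tendsto_intros k0)
    then have lim: "(\<lambda>n. s *\<^sub>R e + (k n * t) *\<^sub>R e') \<longlonglongrightarrow> s *\<^sub>R e + 0 *\<^sub>R e'" for s
      by (intro tendsto_intros) simp
    have "isCont (\<lambda>y. f y * E y) x" for x
      using continuous_on_mult[OF schwartz_continuous[OF f] contE, of UNIV]
      by (simp add: continuous_on_eq_continuous_at)
    from isCont_tendsto_compose[OF this lim]
    show "AE s in lborel. (\<lambda>n. f (s *\<^sub>R e + (k n * t) *\<^sub>R e') * E (s *\<^sub>R e + (k n * t) *\<^sub>R e'))
        \<longlonglongrightarrow> f (s *\<^sub>R e + 0 *\<^sub>R e') * E (s *\<^sub>R e + 0 *\<^sub>R e')"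
      by (intro AE_I2)
  qed (use bnd in auto)
  \<comment> \<open>Fubini, the frame \<open>(e, e')\<close>, and rescaling of the coordinate along \<open>e'\<close> by \<open>k n\<close>.\<close>
  have A: "A n = (LINT t|lborel. of_real (?N t) * \<Psi> (k n * t))" for n
  proof -
    let ?h = "\<lambda>r y. of_real (?G n r) * (1 / (2 * pi) * (f y * exp (- \<i> * complex_of_real (y \<bullet> (p + r *\<^sub>R e')))))"
    have intG: "integrable lborel (\<lambda>r. ?G n r)"
      using lborel_integrable_real_affine[of ?N "k n" 0] k[of n] by (intro integrable_mult_right) simp
    have int: "integrable (lborel \<Otimes>\<^sub>M lborel) (\<lambda>(r, y). ?h r y)"
    proof (rule lborel_pair.Fubini_integrable)
      show "integrable lborel (\<lambda>r. LINT y|lborel. norm (case (r, y) of (r, y) \<Rightarrow> ?h r y))"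
        using intG by (simp add: norm_mult normal_density_nonneg abs_mult norm_divide)
      have "integrable lborel (\<lambda>y. ?h r y)" for r
        by (intro integrable_mult_right Bochner_Integration.integrable_bound[OF schwartz_integrable[OF f]])
          (auto simp: norm_mult)
      then show "AE r in lborel. integrable lborel (\<lambda>y. case (r, y) of (r, y) \<Rightarrow> ?h r y)"
        by simp
    qed measurable
    have "A n = (LINT r|lborel. LINT y|lborel. ?h r y)"
      unfolding A_def fourier2_def by simp
    also have "\<dots> = (LINT y|lborel. LINT r|lborel. ?h r y)"
      by (rule lborel_pair.Fubini_integral[OF int, symmetric])
    also have "\<dots> = (LINT y|lborel. f y * E y * of_real (1 / k n * ?N ((y \<bullet> e') / k n)))"
    proof (rule Bochner_Integration.integral_cong[OF refl])
      fix y :: "real^2"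
      have "?h r y = f y * E y / (2 * pi) * (of_real (?G n r) * exp (- \<i> * complex_of_real (r * (y \<bullet> e'))))" for r
      proof -
        have "exp (- \<i> * complex_of_real (y \<bullet> (p + r *\<^sub>R e'))) = E y * exp (- \<i> * complex_of_real (r * (y \<bullet> e')))"
          unfolding E_def by (simp add: inner_add_right inner_commute algebra_simps flip: exp_add)
        then show ?thesis by simp
      qed
      then have "(LINT r|lborel. ?h r y)
          = f y * E y / (2 * pi) * of_real (2 * pi / k n * ?N ((y \<bullet> e') / k n))"
        by (simp only: integral_mult_right_zero std_normal_fourier_scaled[OF k])
      then show "(LINT r|lborel. ?h r y) = f y * E y * of_real (1 / k n * ?N ((y \<bullet> e') / k n))"
        by simp
    qed
    also have "\<dots> = integral\<^sup>L (lborel \<Otimes>\<^sub>M lborel) (\<lambda>(s, t). f (s *\<^sub>R e + t *\<^sub>R e') * E (s *\<^sub>R e + t *\<^sub>R e')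
        * of_real (1 / k n * ?N (t / k n)))"
      by (subst lborel_frame[of 0 a])
        (simp add: integral_distr case_prod_beta' inner flip: e_def e'_def)
    also have "\<dots> = (LINT t|lborel. LINT s|lborel. f (s *\<^sub>R e + t *\<^sub>R e') * E (s *\<^sub>R e + t *\<^sub>R e')
        * of_real (1 / k n * ?N (t / k n)))"
    proof (rule lborel_pair.integral_snd[symmetric])
      have "integrable lborel (\<lambda>y. f y * E y * of_real (1 / k n * ?N ((y \<bullet> e') / k n)))"
      proof (rule Bochner_Integration.integrable_bound)
        show "integrable lborel (\<lambda>y. of_real (1 / k n) * f y)"
          by (intro integrable_mult_right schwartz_integrable[OF f])
        show "AE y in lborel. norm (f y * E y * of_real (1 / k n * ?N ((y \<bullet> e') / k n)))
            \<le> norm (of_real (1 / k n) * f y)"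
          using k[of n] mult_left_le[OF std_normal_density_bound, of "norm (f _) / k n"]
          by (intro AE_I2) (simp add: norm_mult normE norm_divide normal_density_nonneg)
      qed measurable
      then show "integrable (lborel \<Otimes>\<^sub>M lborel) (\<lambda>(s, t). f (s *\<^sub>R e + t *\<^sub>R e') * E (s *\<^sub>R e + t *\<^sub>R e')
          * of_real (1 / k n * ?N (t / k n)))"
        by (subst (asm) lborel_frame[of 0 a])
          (simp add: integrable_distr_eq case_prod_beta' inner flip: e_def e'_def)
    qed
    also have "\<dots> = (LINT t|lborel. \<Psi> t * of_real (1 / k n * ?N (t / k n)))"
      unfolding \<Psi>_def by (simp only: integral_mult_left_zero)
    also have "\<dots> = \<bar>k n\<bar> *\<^sub>R (LINT t|lborel. \<Psi> (0 + k n * t) * of_real (1 / k n * ?N ((0 + k n * t) / k n)))"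
      using k[of n] by (intro lborel_integral_real_affine) auto
    also have "\<dots> = \<bar>k n\<bar> *\<^sub>R (of_real (1 / k n) * (LINT t|lborel. of_real (?N t) * \<Psi> (k n * t)))"
      using k[of n] by (subst integral_mult_right_zero[symmetric]) (simp add: mult_ac)
    also have "\<dots> = (LINT t|lborel. of_real (?N t) * \<Psi> (k n * t))"
      using k[of n] by (simp add: scaleR_conv_of_real)
    finally show ?thesis .
  qed
  have "A \<longlonglongrightarrow> (LINT r|lborel. fourier2 f (p + r *\<^sub>R e'))"
    unfolding A_def
  proof (rule integral_dominated_convergence)
    have "norm e' = 1" by (simp add: e'_def)
    from integrable_norm[OF fourier2_line_integrable[OF f this, of p]]
    show "integrable lborel (\<lambda>r. norm (fourier2 f (p + r *\<^sub>R e')))" .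
    have one: "sqrt (2 * pi) * ?N x = exp (- x\<^sup>2 / 2)" for x
      by (simp add: normal_density_def)
    show "AE r in lborel. norm (of_real (?G n r) * fourier2 f (p + r *\<^sub>R e')) \<le> norm (fourier2 f (p + r *\<^sub>R e'))" for n
      unfolding one by (intro AE_I2) (simp add: norm_mult mult_left_le_one_le)
    show "AE r in lborel. (\<lambda>n. of_real (?G n r) * fourier2 f (p + r *\<^sub>R e')) \<longlonglongrightarrow> fourier2 f (p + r *\<^sub>R e')"
    proof (rule AE_I2)
      fix r
      have "(\<lambda>n. exp (- (k n * r)\<^sup>2 / 2)) \<longlonglongrightarrow> exp (- (0 * r)\<^sup>2 / 2)"
        by (intro tendsto_intros k0) auto
      then have "(\<lambda>n. ?G n r) \<longlonglongrightarrow> 1" unfolding one by simp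
      from tendsto_mult[OF tendsto_of_real[OF this] tendsto_const]
      show "(\<lambda>n. of_real (?G n r) * fourier2 f (p + r *\<^sub>R e')) \<longlonglongrightarrow> fourier2 f (p + r *\<^sub>R e')"
        by simp
    qed
  qed measurable
  moreover have "A \<longlonglongrightarrow> (LINT t|lborel. of_real (?N t) * \<Psi> 0)"
    unfolding A
  proof (rule integral_dominated_convergence)
    show "integrable lborel (\<lambda>t. ?N t * (LINT s|lborel. C * (1 / (1 + s\<^sup>2))))"
      by (intro integrable_mult_left) simp
    show "AE t in lborel. norm (of_real (?N t) * \<Psi> (k n * t)) \<le> ?N t * (LINT s|lborel. C * (1 / (1 + s\<^sup>2)))" for n
      using \<Psi>_bound by (intro AE_I2) (auto simp: norm_mult normal_density_nonneg intro!: mult_left_mono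
          simp del: times_divide_eq_right mult_1_right integral_mult_right_zero)
    show "AE t in lborel. (\<lambda>n. of_real (?N t) * \<Psi> (k n * t)) \<longlonglongrightarrow> of_real (?N t) * \<Psi> 0"
      by (intro AE_I2 tendsto_mult tendsto_const \<Psi>_lim)
  qed measurable
  moreover have "(LINT t|lborel. of_real (?N t) * \<Psi> 0) = \<Psi> 0"
    by simp
  ultimately have "(LINT r|lborel. fourier2 f (p + r *\<^sub>R e')) = \<Psi> 0"
    using LIMSEQ_unique by metis
  then show ?thesis
    by (simp add: \<Psi>_def E_def e_def e'_def)
qed

section \<open>Fan coordinates and the backprojection integral\<close>

lemma source_eq: "source D \<beta> = D *\<^sub>R unit_vec (\<beta> + pi / 2)"
  by (simp add: source_def vec_eq_iff forall_2 cos_add sin_add)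

lemma norm_source: "norm (source D \<beta>) = \<bar>D\<bar>"
  by (simp add: source_eq)

lemma fan_periodic:
  assumes "w \<in> fan_sinograms"
  shows "w (\<gamma> + of_int k * pi) \<beta> = w \<gamma> \<beta>" "w (\<gamma> + pi) \<beta> = w \<gamma> \<beta>" "w \<gamma> (\<beta> + 2 * pi) = w \<gamma> \<beta>"
proof -
  show 1: "w (\<gamma> + pi) \<beta> = w \<gamma> \<beta>" for \<gamma>
    using assms by (simp add: fan_sinograms_def)
  then show "w (\<gamma> + of_int k * pi) \<beta> = w \<gamma> \<beta>"
    by (rule periodic_of_int[where f = "\<lambda>\<gamma>. w \<gamma> \<beta>"])
  show "w \<gamma> (\<beta> + 2 * pi) = w \<gamma> \<beta>"
    using assms by (simp add: fan_sinograms_def)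
qed

text \<open>The fan angle inverts the fan coordinates of a point, up to a multiple of \<open>pi\<close>, which
  \<open>w\<close> does not see. The radius \<open>r\<close> is signed; negative \<open>r\<close> lie on the side of the origin
  when \<open>cos \<gamma> > 0\<close>.\<close>

lemma fan_angle_ray:
  assumes w: "w \<in> fan_sinograms" and D: "D > 0" and r: "r \<noteq> 0"
  shows "w (fan_angle D \<beta> (source D \<beta> + r *\<^sub>R unit_vec (\<beta> + pi / 2 + \<gamma>))) \<beta> = w \<gamma> \<beta>"
proof -
  \<comment> \<open>Replacing \<open>\<gamma>\<close> by \<open>\<gamma> + pi\<close> if necessary, \<open>x\<close> lies at the signed distance \<open>- \<bar>r\<bar>\<close> along its ray.\<close>
  define \<gamma>' where "\<gamma>' = (if r < 0 then \<gamma> else \<gamma> + pi)"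
  define x where "x = source D \<beta> + r *\<^sub>R unit_vec (\<beta> + pi / 2 + \<gamma>)"
  have x: "x = source D \<beta> - \<bar>r\<bar> *\<^sub>R unit_vec (\<beta> + pi / 2 + \<gamma>')"
    using unit_vec_plus_pi[of "\<beta> + pi / 2 + \<gamma>"] by (auto simp: x_def \<gamma>'_def add.assoc)
  have w': "w \<gamma>' \<beta> = w \<gamma> \<beta>"
    by (simp add: \<gamma>'_def fan_periodic[OF w])
  have quot: "source D \<beta> \<bullet> (source D \<beta> - x) / (D * norm (source D \<beta> - x)) = cos \<gamma>'"
    using D r by (simp add: x source_eq inner_unit_vec)
  define \<alpha> where "\<alpha> = arccos (cos \<gamma>')"
  have cos: "cos \<gamma>' = cos \<alpha>"
    unfolding \<alpha>_def by (rule cos_arccos[symmetric]) auto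
  have line: "x \<bullet> unit_vec (\<beta> + \<alpha>) = D * sin \<alpha> + \<bar>r\<bar> * sin (\<gamma>' - \<alpha>)"
  proof -
    have "x \<bullet> unit_vec (\<beta> + \<alpha>) = D * cos (pi / 2 - \<alpha>) - \<bar>r\<bar> * cos (pi / 2 + (\<gamma>' - \<alpha>))"
      by (simp add: x source_eq inner_diff_left inner_unit_vec algebra_simps)
    then show ?thesis by (simp add: cos_add sin_diff cos_diff sin_add algebra_simps)
  qed
  \<comment> \<open>The test in \<open>fan_angle\<close> succeeds iff \<open>\<gamma>'\<close> and \<open>\<alpha>\<close> agree modulo \<open>pi\<close>.\<close>
  have fa: "fan_angle D \<beta> x = (if sin (\<gamma>' - \<alpha>) = 0 then \<alpha> else - \<alpha>)"
    unfolding fan_angle_def Let_def quot \<alpha>_def[symmetric] line using r by simp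
  have "w (fan_angle D \<beta> x) \<beta> = w \<gamma>' \<beta>"
  proof (cases "sin (\<gamma>' - \<alpha>) = 0")
    case True
    then obtain i where "\<gamma>' - \<alpha> = of_int i * pi"
      using sin_zero_iff_int2 by auto
    then have "\<gamma>' = \<alpha> + of_int i * pi" by simp
    then show ?thesis using True fa by (simp add: fan_periodic[OF w])
  next
    case False
    obtain n where n: "n \<in> \<int>" "\<gamma>' = \<alpha> + 2 * n * pi \<or> \<gamma>' = - \<alpha> + 2 * n * pi"
      using cos unfolding cos_eq by blast
    then obtain i where i: "n = of_int i" by (elim Ints_cases)
    have "\<gamma>' \<noteq> \<alpha> + 2 * n * pi"
    proof
      assume "\<gamma>' = \<alpha> + 2 * n * pi"
      then have "\<gamma>' - \<alpha> = of_int (2 * i) * pi" using i by simp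
      then have "sin (\<gamma>' - \<alpha>) = 0" using sin_zero_iff_int2 by blast
      with False show False by simp
    qed
    with n i have "\<gamma>' = - \<alpha> + of_int (2 * i) * pi" by simp
    then show ?thesis
      using False fa fan_periodic(1)[OF w, of "- \<alpha>" "2 * i" \<beta>] by simp
  qed
  then show ?thesis by (simp add: w' x_def)
qed

text \<open>A Borel measurable version of \<open>arccos\<close>: its argument is clamped to \<open>{-1..1}\<close>, outside of
  which \<open>arccos\<close> is unspecified.\<close>

definition clamped_arccos :: "real \<Rightarrow> real" where
  "clamped_arccos y = arccos (max (- 1) (min 1 y))"

lemma clamped_arccos: "- 1 \<le> y \<Longrightarrow> y \<le> 1 \<Longrightarrow> clamped_arccos y = arccos y"
  by (simp add: clamped_arccos_def)

lemma measurable_clamped_arccos [measurable]: "clamped_arccos \<in> borel_measurable borel"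
proof (rule borel_measurable_continuous_onI)
  have "continuous_on UNIV (\<lambda>y::real. max (- 1) (min 1 y))"
    by (intro continuous_on_max continuous_on_min continuous_on_const continuous_on_id)
  then show "continuous_on UNIV clamped_arccos"
    unfolding clamped_arccos_def by (rule continuous_on_arccos) auto
qed

lemma fan_angle_clamped_arccos:
  assumes "D > 0"
  shows "fan_angle D \<beta> x =
    (let \<gamma> = clamped_arccos (source D \<beta> \<bullet> (source D \<beta> - x) / (D * norm (source D \<beta> - x)))
     in if x \<bullet> unit_vec (\<beta> + \<gamma>) = D * sin \<gamma> then \<gamma> else - \<gamma>)"
proof -
  let ?q = "source D \<beta> \<bullet> (source D \<beta> - x) / (D * norm (source D \<beta> - x))"
  have "\<bar>?q\<bar> \<le> 1"
    using Cauchy_Schwarz_ineq2[of "source D \<beta>" "source D \<beta> - x"] assms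
    by (auto simp: norm_source abs_mult divide_le_eq_1)
  then have "clamped_arccos ?q = arccos ?q"
    by (intro clamped_arccos) linarith+
  then show ?thesis by (simp add: fan_angle_def)
qed

lemma measurable_fan_angle:
  assumes D: "D > 0"
  shows "(\<lambda>q. fan_angle D (fst q) (snd q)) \<in> borel_measurable (borel \<Otimes>\<^sub>M borel)"
proof -
  define c where "c q = clamped_arccos (source D (fst q) \<bullet> (source D (fst q) - snd q)
      / (D * norm (source D (fst q) - snd q)))" for q
  have [measurable]: "(\<lambda>q. source D (fst q)) \<in> borel_measurable (borel \<Otimes>\<^sub>M (borel :: (real^2) measure))"
    unfolding source_eq by measurable
  have [measurable]: "c \<in> borel_measurable (borel \<Otimes>\<^sub>M borel)"
    unfolding c_def by measurable
  have "(\<lambda>q. fan_angle D (fst q) (snd q))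
      = (\<lambda>q. if snd q \<bullet> unit_vec (fst q + c q) = D * sin (c q) then c q else - c q)"
    unfolding fan_angle_clamped_arccos[OF D] c_def Let_def ..
  then show ?thesis by simp
qed

lemma fan_measurable:
  assumes w: "w \<in> fan_sinograms" and [measurable]: "f \<in> borel_measurable M" "g \<in> borel_measurable M"
  shows "(\<lambda>x. w (f x) (g x)) \<in> borel_measurable M"
proof -
  have "(\<lambda>(\<gamma>, \<beta>). w \<gamma> \<beta>) \<in> borel_measurable (borel \<Otimes>\<^sub>M borel)"
    using w unfolding fan_sinograms_def borel_prod by simp
  moreover have "(\<lambda>x. (f x, g x)) \<in> measurable M (borel \<Otimes>\<^sub>M borel)" by measurable
  ultimately show ?thesis
    using measurable_compose by fastforce
qed

lemma fan_nn_integral_finite: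
  assumes w: "w \<in> fan_sinograms"
  shows "(\<integral>\<^sup>+\<gamma>\<in>{0..2 * pi}. (\<integral>\<^sup>+\<beta>\<in>{0..2 * pi}. ennreal \<bar>w \<gamma> \<beta>\<bar> \<partial>lborel) \<partial>lborel) < \<infinity>"
proof -
  note [measurable] = fan_measurable[OF w]
  define V where "V \<gamma> = (\<integral>\<^sup>+\<beta>\<in>{0..2 * pi}. ennreal \<bar>w \<gamma> \<beta>\<bar> \<partial>lborel)" for \<gamma>
  have [measurable]: "V \<in> borel_measurable borel" unfolding V_def by measurable
  have per: "V (\<gamma> + pi) = V \<gamma>" for \<gamma>
    by (simp add: V_def fan_periodic[OF w])
  have "(\<integral>\<^sup>+\<gamma>\<in>{0..2 * pi}. V \<gamma> \<partial>lborel)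
      = (\<integral>\<^sup>+\<gamma>\<in>{0..pi}. V \<gamma> \<partial>lborel) + (\<integral>\<^sup>+\<gamma>\<in>{pi..pi + pi}. V \<gamma> \<partial>lborel)"
    by (subst nn_integral_split[of V 0 pi]) auto
  also have "(\<integral>\<^sup>+\<gamma>\<in>{pi..pi + pi}. V \<gamma> \<partial>lborel) = (\<integral>\<^sup>+\<gamma>\<in>{0..pi}. V \<gamma> \<partial>lborel)"
    by (rule nn_integral_periodic) (auto simp: per)
  finally have eq: "(\<integral>\<^sup>+\<gamma>\<in>{0..2 * pi}. V \<gamma> \<partial>lborel)
      = (\<integral>\<^sup>+\<gamma>\<in>{0..pi}. V \<gamma> \<partial>lborel) + (\<integral>\<^sup>+\<gamma>\<in>{0..pi}. V \<gamma> \<partial>lborel)" .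
  let ?R = "{0..pi} \<times> {0..2 * pi}"
  have "set_integrable lborel ?R (\<lambda>(\<gamma>, \<beta>). (w \<gamma> \<beta>)\<^sup>2)"
    using w by (simp add: fan_sinograms_def)
  then have 1: "integrable (lborel \<Otimes>\<^sub>M lborel) (\<lambda>q. indicator ?R q *\<^sub>R (w (fst q) (snd q))\<^sup>2)"
    by (simp add: set_integrable_def lborel_prod case_prod_beta')
  have "compact ?R" by (intro compact_Times compact_Icc)
  then have "integrable lborel (indicator ?R :: real \<times> real \<Rightarrow> real)"
    by (intro integrable_real_indicator emeasure_compact_finite) (auto intro: borel_compact)
  then have 2: "integrable (lborel \<Otimes>\<^sub>M lborel) (indicator ?R :: real \<times> real \<Rightarrow> real)"
    by (simp add: lborel_prod)
  have "(\<integral>\<^sup>+\<gamma>\<in>{0..pi}. V \<gamma> \<partial>lborel) = (\<integral>\<^sup>+\<gamma>. \<integral>\<^sup>+\<beta>. ennreal (indicator ?R (\<gamma>, \<beta>) * \<bar>w \<gamma> \<beta>\<bar>) \<partial>lborel \<partial>lborel)"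
    unfolding V_def
    by (subst nn_integral_multc[symmetric], measurable)
       (auto intro!: nn_integral_cong split: split_indicator)
  also have "\<dots> = (\<integral>\<^sup>+q. ennreal (indicator ?R q * \<bar>w (fst q) (snd q)\<bar>) \<partial>(lborel \<Otimes>\<^sub>M lborel))"
    by (subst lborel.nn_integral_fst[symmetric]) auto
  also have "\<dots> \<le> (\<integral>\<^sup>+q. ennreal (indicator ?R q + indicator ?R q *\<^sub>R (w (fst q) (snd q))\<^sup>2) \<partial>(lborel \<Otimes>\<^sub>M lborel))"
  proof (intro nn_integral_mono ennreal_leI)
    fix q
    \<comment> \<open>Square integrability implies integrability on a set of finite measure.\<close>
    have "\<bar>t\<bar> \<le> 1 + t\<^sup>2" for t :: real
      using zero_le_power2[of "\<bar>t\<bar> - 1"] zero_le_power2[of t] unfolding power2_diff by simp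
    then show "indicator ?R q * \<bar>w (fst q) (snd q)\<bar> \<le> indicator ?R q + indicator ?R q *\<^sub>R (w (fst q) (snd q))\<^sup>2"
      by (simp add: indicator_def)
  qed
  also have "\<dots> < \<infinity>"
    using Bochner_Integration.integrable_add[OF 2 1] by (subst (asm) integrable_iff_bounded) simp
  finally show ?thesis
    using eq unfolding V_def by simp
qed

lemma lborel_fan_integrable:
  assumes w: "w \<in> fan_sinograms"
  shows "integrable (lborel \<Otimes>\<^sub>M lborel)
    (\<lambda>(\<gamma>, \<beta>). indicator {0..2 * pi} \<gamma> * indicator {0..2 * pi} \<beta> * w \<gamma> \<beta>)"
proof (rule integrableI_bounded)
  note [measurable] = fan_measurable[OF w]
  show "(\<lambda>(\<gamma>, \<beta>). indicator {0..2 * pi} \<gamma> * indicator {0..2 * pi} \<beta> * w \<gamma> \<beta>) \<in> borel_measurable (lborel \<Otimes>\<^sub>M lborel)"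
    by measurable
  have "(\<integral>\<^sup>+q. ennreal (norm (case q of (\<gamma>, \<beta>) \<Rightarrow> indicator {0..2 * pi} \<gamma> * indicator {0..2 * pi} \<beta> * w \<gamma> \<beta>)) \<partial>(lborel \<Otimes>\<^sub>M lborel))
    = (\<integral>\<^sup>+\<gamma>. \<integral>\<^sup>+\<beta>. ennreal \<bar>w \<gamma> \<beta>\<bar> * indicator {0..2 * pi} \<beta> * indicator {0..2 * pi} \<gamma> \<partial>lborel \<partial>lborel)"
    by (subst lborel.nn_integral_fst[symmetric]) (auto intro!: nn_integral_cong split: split_indicator)
  also have "\<dots> = (\<integral>\<^sup>+\<gamma>\<in>{0..2 * pi}. (\<integral>\<^sup>+\<beta>\<in>{0..2 * pi}. ennreal \<bar>w \<gamma> \<beta>\<bar> \<partial>lborel) \<partial>lborel)"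
    by (subst nn_integral_multc) auto
  finally show "(\<integral>\<^sup>+q. ennreal (norm (case q of (\<gamma>, \<beta>) \<Rightarrow> indicator {0..2 * pi} \<gamma> * indicator {0..2 * pi} \<beta> * w \<gamma> \<beta>)) \<partial>(lborel \<Otimes>\<^sub>M lborel)) < \<infinity>"
    using fan_nn_integral_finite[OF w] by simp
qed

text \<open>Fubini, and polar coordinates around the source for every fixed \<open>\<beta>\<close>. Their weight \<open>\<bar>r\<bar> / 2\<close>
  cancels the factor \<open>1 / norm (source D \<beta> - x)\<close> of the backprojection.\<close>

lemma fan_adjoint_pairing:
  assumes D: "D > 0" and w: "w \<in> fan_sinograms" and f: "f \<in> schwartz_space"
  shows "integrable lborel (\<lambda>x. complex_of_real (fan_adjoint D w x) * fourier2 f x)"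
    and "(LINT x|lborel. complex_of_real (fan_adjoint D w x) * fourier2 f x)
      = (LINT \<beta>|lborel. LINT \<gamma>|lborel. of_real (indicator {0..2 * pi} \<gamma> * indicator {0..2 * pi} \<beta> * w \<gamma> \<beta> / 2)
          * (LINT r|lborel. fourier2 f (source D \<beta> + r *\<^sub>R unit_vec (\<beta> + pi / 2 + \<gamma>))))"
proof -
  let ?I = "indicator {0..2 * pi} :: real \<Rightarrow> real"
  let ?J = "indicator {0..2 * pi} :: real \<Rightarrow> ennreal"
  define g where "g = fourier2 f"
  define K where "K \<beta> x = complex_of_real (?I \<beta> * (1 / norm (source D \<beta> - x) * w (fan_angle D \<beta> x) \<beta>)) * g x" for \<beta> x
  have [measurable]: "g \<in> borel_measurable borel"
    unfolding g_def by (rule fourier2_measurable[OF f])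
  have [measurable]: "(\<lambda>q. fan_angle D (fst q) (snd q)) \<in> borel_measurable (lborel \<Otimes>\<^sub>M lborel)"
    using measurable_fan_angle[OF D] by simp
  note [measurable] = fan_measurable[OF w]
  have mK [measurable]: "(\<lambda>(\<beta>, x). K \<beta> x) \<in> borel_measurable (lborel \<Otimes>\<^sub>M lborel)"
    unfolding K_def case_prod_beta' source_eq by measurable
  have mK1 [measurable]: "K \<beta> \<in> borel_measurable borel" for \<beta>
    using measurable_compose[OF measurable_Pair1' mK, of \<beta>] by simp
  \<comment> \<open>The integrand in polar coordinates around the source; \<open>r = 0\<close>, where the right-hand side
    need not vanish, is a null set.\<close>
  have Kray: "(?I \<gamma> * (\<bar>r\<bar> / 2)) *\<^sub>R K \<beta> (source D \<beta> + r *\<^sub>R unit_vec (\<beta> + pi / 2 + \<gamma>))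
      = of_real (?I \<gamma> * ?I \<beta> * w \<gamma> \<beta> / 2) * g (source D \<beta> + r *\<^sub>R unit_vec (\<beta> + pi / 2 + \<gamma>))"
    if "r \<noteq> 0" for \<beta> \<gamma> r
    using that by (simp add: K_def fan_angle_ray[OF w D] scaleR_conv_of_real[where 'a = complex])
  obtain C where C: "C \<ge> 0"
      "\<And>p u r. norm u = 1 \<Longrightarrow> norm (g (p + r *\<^sub>R u)) \<le> C * (2 + 2 * (norm p)\<^sup>2) * (1 / (1 + r\<^sup>2))"
    using fourier2_line_decay[OF f] unfolding g_def by metis
  define c where "c = (\<integral>\<^sup>+r. ennreal (C * (2 + 2 * D\<^sup>2) * (1 / (1 + r\<^sup>2))) \<partial>lborel)"
  have "integrable lborel (\<lambda>r. C * (2 + 2 * D\<^sup>2) * (1 / (1 + r\<^sup>2)))"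
    by (intro integrable_mult_right integrable_inverse_1_plus_square_real)
  then have c: "c < \<infinity>"
    unfolding c_def integrable_iff_bounded using C(1) by (simp add: abs_mult abs_of_nonneg add_nonneg_nonneg)
  have intK: "integrable (lborel \<Otimes>\<^sub>M lborel) (\<lambda>(\<beta>, x). K \<beta> x)"
  proof (rule integrableI_bounded)
    have inner: "(\<integral>\<^sup>+x. ennreal (norm (K \<beta> x)) \<partial>lborel)
        \<le> (\<integral>\<^sup>+\<gamma>. ennreal \<bar>w \<gamma> \<beta>\<bar> * ?J \<beta> * ?J \<gamma> \<partial>lborel) * c" for \<beta>
    proof -
      let ?x = "\<lambda>\<gamma> r. source D \<beta> + r *\<^sub>R unit_vec (\<beta> + pi / 2 + \<gamma>)"
      have "(\<integral>\<^sup>+x. ennreal (norm (K \<beta> x)) \<partial>lborel)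
          = (\<integral>\<^sup>+\<gamma>\<in>{0..2 * pi}. (\<integral>\<^sup>+r. ennreal (\<bar>r\<bar> / 2) * ennreal (norm (K \<beta> (?x \<gamma> r))) \<partial>lborel) \<partial>lborel)"
        by (rule nn_integral_polar) measurable
      also have "\<dots> \<le> (\<integral>\<^sup>+\<gamma>. ennreal \<bar>w \<gamma> \<beta>\<bar> * ?J \<beta> * ?J \<gamma> * c \<partial>lborel)"
      proof (rule nn_integral_mono)
        fix \<gamma> :: real
        show "(\<integral>\<^sup>+r. ennreal (\<bar>r\<bar> / 2) * ennreal (norm (K \<beta> (?x \<gamma> r))) \<partial>lborel) * ?J \<gamma>
            \<le> ennreal \<bar>w \<gamma> \<beta>\<bar> * ?J \<beta> * ?J \<gamma> * c"
        proof (cases "\<gamma> \<in> {0..2 * pi}")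
          case True
          have "(\<integral>\<^sup>+r. ennreal (\<bar>r\<bar> / 2) * ennreal (norm (K \<beta> (?x \<gamma> r))) \<partial>lborel)
              \<le> (\<integral>\<^sup>+r. ennreal \<bar>w \<gamma> \<beta>\<bar> * ?J \<beta> * ennreal (C * (2 + 2 * D\<^sup>2) * (1 / (1 + r\<^sup>2))) \<partial>lborel)"
          proof (rule nn_integral_mono)
            fix r :: real
            show "ennreal (\<bar>r\<bar> / 2) * ennreal (norm (K \<beta> (?x \<gamma> r)))
                \<le> ennreal \<bar>w \<gamma> \<beta>\<bar> * ?J \<beta> * ennreal (C * (2 + 2 * D\<^sup>2) * (1 / (1 + r\<^sup>2)))"
            proof (cases "r = 0")
              case False
              have b: "norm (g (?x \<gamma> r)) \<le> C * (2 + 2 * D\<^sup>2) * (1 / (1 + r\<^sup>2))"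
                using C(2)[of "unit_vec (\<beta> + pi / 2 + \<gamma>)" "source D \<beta>" r] D by (simp add: norm_source)
              have "ennreal (\<bar>r\<bar> / 2) * ennreal (norm (K \<beta> (?x \<gamma> r)))
                  = ennreal (norm ((?I \<gamma> * (\<bar>r\<bar> / 2)) *\<^sub>R K \<beta> (?x \<gamma> r)))"
                using True by (simp flip: ennreal_mult')
              also have "\<dots> = ennreal (?I \<beta> * \<bar>w \<gamma> \<beta>\<bar> / 2 * norm (g (?x \<gamma> r)))"
                unfolding Kray[OF False] using True by (simp add: norm_mult abs_mult)
              also have "\<dots> \<le> ennreal (\<bar>w \<gamma> \<beta>\<bar> * ?I \<beta> * (C * (2 + 2 * D\<^sup>2) * (1 / (1 + r\<^sup>2))))"
                using mult_mono[OF _ b, of "?I \<beta> * \<bar>w \<gamma> \<beta>\<bar> / 2" "\<bar>w \<gamma> \<beta>\<bar> * ?I \<beta>"]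
                by (intro ennreal_leI) (auto simp: indicator_def)
              also have "\<dots> = ennreal \<bar>w \<gamma> \<beta>\<bar> * ?J \<beta> * ennreal (C * (2 + 2 * D\<^sup>2) * (1 / (1 + r\<^sup>2)))"
                by (subst ennreal_mult') (auto simp: indicator_def)
              finally show ?thesis .
            qed simp
          qed
          also have "\<dots> = ennreal \<bar>w \<gamma> \<beta>\<bar> * ?J \<beta> * c"
            unfolding c_def by (rule nn_integral_cmult) measurable
          finally show ?thesis using True by simp
        qed simp
      qed
      also have "\<dots> = (\<integral>\<^sup>+\<gamma>. ennreal \<bar>w \<gamma> \<beta>\<bar> * ?J \<beta> * ?J \<gamma> \<partial>lborel) * c"
        by (rule nn_integral_multc) measurable
      finally show ?thesis .
    qed
    have "(\<integral>\<^sup>+q. ennreal (norm (case q of (\<beta>, x) \<Rightarrow> K \<beta> x)) \<partial>(lborel \<Otimes>\<^sub>M lborel))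
        = (\<integral>\<^sup>+\<beta>. \<integral>\<^sup>+x. ennreal (norm (K \<beta> x)) \<partial>lborel \<partial>lborel)"
      by (subst lborel.nn_integral_fst[symmetric]) auto
    also have "\<dots> \<le> (\<integral>\<^sup>+\<beta>. (\<integral>\<^sup>+\<gamma>. ennreal \<bar>w \<gamma> \<beta>\<bar> * ?J \<beta> * ?J \<gamma> \<partial>lborel) * c \<partial>lborel)"
      by (intro nn_integral_mono inner)
    also have "\<dots> = (\<integral>\<^sup>+\<beta>. \<integral>\<^sup>+\<gamma>. ennreal \<bar>w \<gamma> \<beta>\<bar> * ?J \<beta> * ?J \<gamma> \<partial>lborel \<partial>lborel) * c"
      by (rule nn_integral_multc) measurable
    also have "(\<integral>\<^sup>+\<beta>. \<integral>\<^sup>+\<gamma>. ennreal \<bar>w \<gamma> \<beta>\<bar> * ?J \<beta> * ?J \<gamma> \<partial>lborel \<partial>lborel)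
        = (\<integral>\<^sup>+\<gamma>. \<integral>\<^sup>+\<beta>. ennreal \<bar>w \<gamma> \<beta>\<bar> * ?J \<beta> * ?J \<gamma> \<partial>lborel \<partial>lborel)"
      by (rule lborel_pair.Fubini') measurable
    also have "\<dots> = (\<integral>\<^sup>+\<gamma>\<in>{0..2 * pi}. (\<integral>\<^sup>+\<beta>\<in>{0..2 * pi}. ennreal \<bar>w \<gamma> \<beta>\<bar> \<partial>lborel) \<partial>lborel)"
      by (subst nn_integral_multc) auto
    also have "\<dots> * c < \<infinity>"
      using fan_nn_integral_finite[OF w] c by (simp add: ennreal_mult_less_top)
    finally show "(\<integral>\<^sup>+q. ennreal (norm (case q of (\<beta>, x) \<Rightarrow> K \<beta> x)) \<partial>(lborel \<Otimes>\<^sub>M lborel)) < \<infinity>" .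
  qed measurable
  have adj: "complex_of_real (fan_adjoint D w x) * g x = (LINT \<beta>|lborel. K \<beta> x)" for x
    by (simp only: fan_adjoint_def set_lebesgue_integral_def K_def integral_mult_left_zero
      integral_complex_of_real real_scaleR_def)
  show "integrable lborel (\<lambda>x. complex_of_real (fan_adjoint D w x) * fourier2 f x)"
    using lborel_pair.integrable_snd[OF intK] unfolding adj[unfolded g_def] by simp
  have "(LINT x|lborel. complex_of_real (fan_adjoint D w x) * g x) = (LINT x|lborel. LINT \<beta>|lborel. K \<beta> x)"
    by (simp add: adj)
  also have "\<dots> = (LINT \<beta>|lborel. LINT x|lborel. K \<beta> x)"
    by (rule lborel_pair.Fubini_integral[OF intK])
  also have "\<dots> = (LINT \<beta>|lborel. LINT \<gamma>|lborel. of_real (?I \<gamma> * ?I \<beta> * w \<gamma> \<beta> / 2)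
          * (LINT r|lborel. g (source D \<beta> + r *\<^sub>R unit_vec (\<beta> + pi / 2 + \<gamma>))))"
  proof (rule integral_cong_AE)
    have "AE \<beta> in lborel. integrable lborel (K \<beta>)"
      using lborel_pair.AE_integrable_fst'[OF intK] by simp
    then show "AE \<beta> in lborel. (LINT x|lborel. K \<beta> x) = (LINT \<gamma>|lborel. of_real (?I \<gamma> * ?I \<beta> * w \<gamma> \<beta> / 2)
          * (LINT r|lborel. g (source D \<beta> + r *\<^sub>R unit_vec (\<beta> + pi / 2 + \<gamma>))))"
    proof eventually_elim
      case (elim \<beta>)
      let ?x = "\<lambda>\<gamma> r. source D \<beta> + r *\<^sub>R unit_vec (\<beta> + pi / 2 + \<gamma>)"
      let ?k = "\<lambda>\<gamma> r. (?I \<gamma> * (\<bar>r\<bar> / 2)) *\<^sub>R K \<beta> (?x \<gamma> r)"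
      have int: "integrable (lborel \<Otimes>\<^sub>M lborel) (\<lambda>(\<gamma>, r). ?k \<gamma> r)"
        using elim integral_polar(1)[OF mK1] by blast
      have "(LINT x|lborel. K \<beta> x) = (LINT \<gamma>|lborel. LINT r|lborel. ?k \<gamma> r)"
        using integral_polar(2)[OF mK1] lborel_pair.integral_fst[OF int] by metis
      also have "\<dots> = (LINT \<gamma>|lborel. LINT r|lborel. of_real (?I \<gamma> * ?I \<beta> * w \<gamma> \<beta> / 2) * g (?x \<gamma> r))"
      proof (rule Bochner_Integration.integral_cong[OF refl])
        fix \<gamma>
        have "AE r in lborel. r \<noteq> (0::real)" by (rule AE_lborel_singleton)
        then have AE: "AE r in lborel. ?k \<gamma> r = of_real (?I \<gamma> * ?I \<beta> * w \<gamma> \<beta> / 2) * g (?x \<gamma> r)"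
          by (rule eventually_mono) (rule Kray)
        show "(LINT r|lborel. ?k \<gamma> r) = (LINT r|lborel. of_real (?I \<gamma> * ?I \<beta> * w \<gamma> \<beta> / 2) * g (?x \<gamma> r))"
          by (rule integral_cong_AE[OF _ _ AE]) measurable
      qed
      finally show ?case by simp
    qed
  next
    show "(\<lambda>\<beta>. LINT x|lborel. K \<beta> x) \<in> borel_measurable lborel"
      by (rule lborel.borel_measurable_lebesgue_integral[OF mK])
    show "(\<lambda>\<beta>. LINT \<gamma>|lborel. of_real (?I \<gamma> * ?I \<beta> * w \<gamma> \<beta> / 2)
          * (LINT r|lborel. g (source D \<beta> + r *\<^sub>R unit_vec (\<beta> + pi / 2 + \<gamma>)))) \<in> borel_measurable lborel"
      unfolding source_eq by measurable
  qed
  finally show "(LINT x|lborel. complex_of_real (fan_adjoint D w x) * fourier2 f x)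
      = (LINT \<beta>|lborel. LINT \<gamma>|lborel. of_real (indicator {0..2 * pi} \<gamma> * indicator {0..2 * pi} \<beta> * w \<gamma> \<beta> / 2)
          * (LINT r|lborel. fourier2 f (source D \<beta> + r *\<^sub>R unit_vec (\<beta> + pi / 2 + \<gamma>))))"
    unfolding g_def .
qed

section \<open>The Jacobi-Anger expansion\<close>

lemma exp_has_sum:
  fixes z :: complex
  shows "((\<lambda>n. z ^ n / fact n) has_sum exp z) UNIV"
    and "(\<lambda>n. norm (z ^ n / fact n)) summable_on UNIV"
proof -
  have n: "summable (\<lambda>n. norm (z ^ n / fact n))"
    using summable_norm_exp[of z] by (simp add: scaleR_conv_of_real divide_inverse mult.commute)
  have "(\<lambda>n. z ^ n / fact n) sums exp z"
    using exp_converges[of z] by (simp add: scaleR_conv_of_real divide_inverse mult.commute)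
  with n show *: "((\<lambda>n. z ^ n / fact n) has_sum exp z) UNIV"
    by (rule norm_summable_imp_has_sum)
  then show "(\<lambda>n. norm (z ^ n / fact n)) summable_on UNIV"
    by (rule iffD1[OF summable_on_iff_abs_summable_on_complex has_sum_imp_summable])
qed

lemma bessel_term_sums:
  assumes "((\<lambda>k. c * complex_of_real ((-1) ^ k / (fact k * fact (n + k)) * (x / 2) ^ (2 * k + n))) summable_on UNIV)"
    and "c \<noteq> 0"
  shows "((\<lambda>k. c * complex_of_real ((-1) ^ k / (fact k * fact (n + k)) * (x / 2) ^ (2 * k + n)))
    has_sum (c * complex_of_real (bessel_J n x))) UNIV"
proof -
  let ?t = "\<lambda>k. (-1) ^ k / (fact k * fact (n + k)) * (x / 2) ^ (2 * k + n)"
  obtain S where S: "((\<lambda>k. c * complex_of_real (?t k)) has_sum S) UNIV"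
    using assms(1) by (auto simp: summable_on_def)
  then have s: "(\<lambda>k. c * complex_of_real (?t k)) sums S"
    by (rule has_sum_imp_sums)
  from sums_mult[OF this, of "inverse c"] have "(\<lambda>k. complex_of_real (?t k)) sums (inverse c * S)"
    using \<open>c \<noteq> 0\<close> by (simp flip: mult.assoc)
  from sums_Re[OF this] have "?t sums Re (inverse c * S)"
    by (simp only: Re_complex_of_real)
  then have "?t sums bessel_J n x"
    unfolding bessel_J_def by (simp add: sums_iff)
  from sums_mult[OF sums_of_real[OF this, where 'a = complex], of c]
  have "S = c * complex_of_real (bessel_J n x)"
    using s sums_unique2 by blast
  with S show ?thesis by simp
qed

text \<open>With \<open>u = exp (- \<i> \<gamma>)\<close> and \<open>v = cnj u = 1 / u\<close> the exponential is
  \<open>exp (x u / 2) * exp (- x v / 2)\<close>. The terms of the double power series with exponents \<open>(n + k, k)\<close> add up to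
  \<open>J\<^sub>n(x) u\<^sup>n\<close>, and for \<open>n \<ge> 1\<close> those with exponents \<open>(k, n + k)\<close> to \<open>J\<^sub>n(x) (- v)\<^sup>n\<close>.\<close>

theorem jacobi_anger:
  fixes x \<gamma> :: real
  shows "(\<lambda>n. complex_of_real (bessel_J n x) *
      (if n = 0 then 1 else exp (- \<i> * of_nat n * of_real \<gamma>) + (-1) ^ n * cnj (exp (- \<i> * of_nat n * of_real \<gamma>))))
    sums exp (- \<i> * of_real (x * sin \<gamma>))"
    and "summable (\<lambda>n. \<bar>bessel_J n x\<bar>)"
proof -
  define u where "u = exp (- \<i> * complex_of_real \<gamma>)"
  define v where "v = cnj u"
  have u: "u = cos \<gamma> - \<i> * sin \<gamma>"
    unfolding u_def by (simp add: exp_minus cis_conv_exp[symmetric] complex_eq_iff)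
  have v: "v = cos \<gamma> + \<i> * sin \<gamma>"
    unfolding v_def u by simp
  have uv: "u * v = 1"
    unfolding u v by (simp add: complex_eq_iff power2_eq_square[symmetric])
  have un: "exp (- \<i> * of_nat n * of_real \<gamma>) = u ^ n" for n
    unfolding u_def by (simp add: exp_of_nat_mult[symmetric] mult_ac)
  define A where "A p = (of_real (x / 2) * u) ^ p / fact p" for p
  define B where "B q = (of_real (- (x / 2)) * v) ^ q / fact q" for q
  define a where "a = (\<lambda>(p, q). A p * B q)"
  define S where "S = exp (- \<i> * complex_of_real (x * sin \<gamma>))"
  have A: "(A has_sum exp (of_real (x / 2) * u)) UNIV" "(\<lambda>p. norm (A p)) summable_on UNIV"
    unfolding A_def by (rule exp_has_sum)+
  have B: "(B has_sum exp (of_real (- (x / 2)) * v)) UNIV" "(\<lambda>q. norm (B q)) summable_on UNIV"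
    unfolding B_def by (rule exp_has_sum)+
  have summ: "(\<lambda>q. norm (a q)) summable_on (UNIV \<times> UNIV)"
    unfolding Infinite_Sum.abs_summable_on_Sigma_iff
  proof (intro conjI ballI)
    show "(\<lambda>q. norm (a (p, q))) summable_on UNIV" for p
      using B(2) by (simp add: a_def norm_mult summable_on_cmult_right)
    show "(\<lambda>p. norm (\<Sum>\<^sub>\<infinity>q. norm (a (p, q)))) summable_on UNIV"
      using A(2) by (simp add: a_def norm_mult infsum_cmult_right' abs_mult infsum_nonneg summable_on_cmult_left)
  qed
  have "(a has_sum (exp (of_real (x / 2) * u) * exp (of_real (- (x / 2)) * v))) (UNIV \<times> UNIV)"
  proof (rule has_sum_SigmaI)
    show "((\<lambda>q. a (p, q)) has_sum (A p * exp (of_real (- (x / 2)) * v))) UNIV" for p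
      unfolding a_def using B(1) by (simp add: has_sum_cmult_right)
    show "((\<lambda>p. A p * exp (of_real (- (x / 2)) * v)) has_sum (exp (of_real (x / 2) * u) * exp (of_real (- (x / 2)) * v))) UNIV"
      using A(1) by (rule has_sum_cmult_left)
    show "a summable_on (UNIV \<times> UNIV)"
      using summ by (rule Infinite_Sum.abs_summable_summable)
  qed
  also have "exp (of_real (x / 2) * u) * exp (of_real (- (x / 2)) * v) = S"
    unfolding S_def u v by (simp add: algebra_simps flip: exp_add)
  finally have aS: "(a has_sum S) UNIV" by simp
  \<comment> \<open>The index pairs on or below the diagonal are \<open>range ?g\<close>, those above it \<open>range ?h\<close>.\<close>
  let ?g = "\<lambda>(n, k). (n + k, k) :: nat \<times> nat"
  let ?h = "\<lambda>(n, k). (k, Suc n + k) :: nat \<times> nat"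
  have inj: "inj ?g" "inj ?h" by (auto simp: inj_on_def)
  have un_gh: "range ?g \<union> range ?h = UNIV" and dis: "range ?g \<inter> range ?h = {}"
  proof -
    have "q \<in> range ?g \<union> range ?h" for q
    proof (cases "snd q \<le> fst q")
      case True
      then have "q = ?g (fst q - snd q, snd q)" by (simp add: prod_eq_iff)
      then show ?thesis by blast
    next
      case False
      then have "q = ?h (snd q - fst q - 1, fst q)" by (simp add: prod_eq_iff)
      then show ?thesis by blast
    qed
    then show "range ?g \<union> range ?h = UNIV" by blast
    show "range ?g \<inter> range ?h = {}" by auto
  qed
  have asum: "a summable_on R" for R
    using has_sum_imp_summable[OF aS] by (rule summable_on_subset_banach) simp
  obtain S1 S2 where S1: "(a has_sum S1) (range ?g)" and S2: "(a has_sum S2) (range ?h)"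
    using asum by (meson summable_on_def)
  have S: "S = S1 + S2"
    using has_sum_Un_disjoint[OF S1 S2 dis] aS unfolding un_gh by (rule has_sum_unique[rotated])
  have g: "((a \<circ> ?g) has_sum S1) (UNIV \<times> UNIV)"
    using S1 has_sum_reindex[OF inj(1), of a S1] by simp
  have h: "((a \<circ> ?h) has_sum S2) (UNIV \<times> UNIV)"
    using S2 has_sum_reindex[OF inj(2), of a S2] by simp
  have uvk: "u ^ (n + k) * v ^ k = u ^ n" "u ^ k * v ^ (n + k) = v ^ n" for n k
    using uv by (simp_all add: power_add mult_ac flip: power_mult_distrib)
  have pw: "y ^ (n + k) * (- y) ^ k = (-1) ^ k * y ^ (2 * k + n)"
      "y ^ k * (- y) ^ (n + k) = (-1) ^ n * (-1) ^ k * y ^ (2 * k + n)" for y :: real and n k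
    by (simp_all add: power_minus[of y] power_add power_mult power2_eq_square power_mult_distrib mult_ac)
  have gk: "(a \<circ> ?g) (n, k) = u ^ n * complex_of_real ((-1) ^ k / (fact k * fact (n + k)) * (x / 2) ^ (2 * k + n))" for n k
  proof -
    have "(a \<circ> ?g) (n, k) = (u ^ (n + k) * v ^ k) * (of_real (x / 2) ^ (n + k) * of_real (- (x / 2)) ^ k) / (fact (n + k) * fact k)"
      unfolding a_def A_def B_def power_mult_distrib
      by (simp only: o_def prod.case times_divide_times_eq mult_ac)
    also have "of_real (x / 2) ^ (n + k) * of_real (- (x / 2)) ^ k = complex_of_real ((-1) ^ k * (x / 2) ^ (2 * k + n))"
      by (simp only: pw(1) flip: of_real_power of_real_mult)
    finally show ?thesis
      unfolding uvk by (simp add: mult_ac)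
  qed
  have hk: "(a \<circ> ?h) (n, k) = (- v) ^ Suc n * complex_of_real ((-1) ^ k / (fact k * fact (Suc n + k)) * (x / 2) ^ (2 * k + Suc n))" for n k
  proof -
    have "(a \<circ> ?h) (n, k) = (u ^ k * v ^ (Suc n + k)) * (of_real (x / 2) ^ k * of_real (- (x / 2)) ^ (Suc n + k)) / (fact k * fact (Suc n + k))"
      unfolding a_def A_def B_def power_mult_distrib
      by (simp only: o_def prod.case times_divide_times_eq mult_ac)
    also have "of_real (x / 2) ^ k * of_real (- (x / 2)) ^ (Suc n + k) = complex_of_real ((-1) ^ Suc n * (-1) ^ k * (x / 2) ^ (2 * k + Suc n))"
      by (simp only: pw(2) flip: of_real_power of_real_mult)
    finally show ?thesis
      unfolding uvk power_minus[of v] by (simp add: mult_ac)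
  qed
  have u0: "u \<noteq> 0" "v \<noteq> 0" using uv by auto
  have hg: "((\<lambda>n. u ^ n * of_real (bessel_J n x)) has_sum S1) UNIV"
  proof (rule has_sum_SigmaD[OF g])
    fix n
    have "(\<lambda>k. (a \<circ> ?g) (n, k)) summable_on UNIV"
      using summable_on_SigmaD1[of "\<lambda>n k. (a \<circ> ?g) (n, k)" UNIV "\<lambda>_. UNIV" n] has_sum_imp_summable[OF g]
      by (simp add: case_prod_beta' o_def)
    then show "((\<lambda>k. (a \<circ> ?g) (n, k)) has_sum u ^ n * of_real (bessel_J n x)) UNIV"
      unfolding gk using u0 by (intro bessel_term_sums) auto
  qed
  have hh: "((\<lambda>n. (- v) ^ Suc n * of_real (bessel_J (Suc n) x)) has_sum S2) UNIV"
  proof (rule has_sum_SigmaD[OF h])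
    fix n
    have "(\<lambda>k. (a \<circ> ?h) (n, k)) summable_on UNIV"
      using summable_on_SigmaD1[of "\<lambda>n k. (a \<circ> ?h) (n, k)" UNIV "\<lambda>_. UNIV" n] has_sum_imp_summable[OF h]
      by (simp add: case_prod_beta' o_def)
    then show "((\<lambda>k. (a \<circ> ?h) (n, k)) has_sum (- v) ^ Suc n * of_real (bessel_J (Suc n) x)) UNIV"
      unfolding hk using u0 by (intro bessel_term_sums) auto
  qed
  have "(\<lambda>n. (if n = 0 then 0 else (- v) ^ n * of_real (bessel_J n x))) sums S2"
  proof (rule sums_Suc_imp)
    show "(\<lambda>n. if Suc n = 0 then 0 else (- v) ^ Suc n * of_real (bessel_J (Suc n) x)) sums S2"
      using has_sum_imp_sums[OF hh] by (simp only: nat.simps if_False)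
  qed simp
  from sums_add[OF has_sum_imp_sums[OF hg] this]
  have "(\<lambda>n. u ^ n * of_real (bessel_J n x) + (if n = 0 then 0 else (- v) ^ n * of_real (bessel_J n x))) sums S"
    by (simp add: S)
  moreover have "u ^ n * of_real (bessel_J n x) + (if n = 0 then 0 else (- v) ^ n * of_real (bessel_J n x))
    = of_real (bessel_J n x) * (if n = 0 then 1 else u ^ n + (-1) ^ n * cnj (u ^ n))" for n
    by (simp add: v_def power_minus[of "cnj u"] algebra_simps)
  ultimately show "(\<lambda>n. complex_of_real (bessel_J n x) *
      (if n = 0 then 1 else exp (- \<i> * of_nat n * of_real \<gamma>) + (-1) ^ n * cnj (exp (- \<i> * of_nat n * of_real \<gamma>))))
    sums exp (- \<i> * of_real (x * sin \<gamma>))"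
    unfolding un S_def by simp
  have "norm u = 1" unfolding u_def by (rule norm_exp_neg_ii)
  moreover have "(\<lambda>n. norm (u ^ n * of_real (bessel_J n x))) summable_on UNIV"
    by (rule iffD1[OF summable_on_iff_abs_summable_on_complex has_sum_imp_summable[OF hg]])
  ultimately have "(\<lambda>n. \<bar>bessel_J n x\<bar>) summable_on UNIV"
    by (simp add: norm_mult norm_power)
  then show "summable (\<lambda>n. \<bar>bessel_J n x\<bar>)"
    by (rule summable_on_imp_summable)
qed

section \<open>The series and its closed form\<close>

lemma schwartz_ray_decay:
  assumes f: "f \<in> schwartz_space"
  obtains C where "C \<ge> 0" "\<And>s a. norm (f (s *\<^sub>R unit_vec a)) \<le> C * (1 / (1 + s\<^sup>2))"
proof -
  obtain C where C: "C \<ge> 0" "\<And>x. norm (f x) \<le> C * (1 / (1 + (norm x)\<^sup>2)\<^sup>2)"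
    using schwartz_decay[OF f] by metis
  \<comment> \<open>The frame estimate with second coordinate \<open>0\<close>.\<close>
  have "norm (f (s *\<^sub>R unit_vec a)) \<le> C * (1 / (1 + s\<^sup>2))" for s a
    using C(2)[of "s *\<^sub>R unit_vec a"] mult_left_mono[OF decay_le_product[of s a 0] C(1)] by simp
  with C(1) show ?thesis by (rule that)
qed

lemma set_integral_shift:
  fixes f :: "real \<Rightarrow> 'a::{banach, second_countable_topology}"
  shows "(LINT x:{a + c..b + c}|lborel. f x) = (LINT x:{a..b}|lborel. f (x + c))"
proof -
  have "(LINT x:{a + c..b + c}|lborel. f x)
      = \<bar>1\<bar> *\<^sub>R (LINT x|lborel. indicator {a + c..b + c} (c + 1 * x) *\<^sub>R f (c + 1 * x))"
    unfolding set_lebesgue_integral_def by (rule lborel_integral_real_affine) simp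
  also have "\<dots> = (LINT x:{a..b}|lborel. f (x + c))"
    unfolding set_lebesgue_integral_def
    by (auto intro!: Bochner_Integration.integral_cong simp: add.commute[of c] split: split_indicator)
  finally show ?thesis .
qed

lemma integrable_unimodular_mult:
  fixes e :: "'a \<Rightarrow> complex" and f :: "'a \<Rightarrow> real"
  assumes [measurable]: "e \<in> borel_measurable M" "f \<in> borel_measurable M" and "\<And>x. norm (e x) = 1"
  shows "integrable M (\<lambda>x. of_real (f x) * e x) \<longleftrightarrow> integrable M f"
proof -
  have "integrable M (\<lambda>x. of_real (f x) * e x) \<longleftrightarrow> integrable M (\<lambda>x. norm (of_real (f x) * e x))"
    by (rule integrable_norm_iff[symmetric]) measurable
  also have "\<dots> \<longleftrightarrow> integrable M (\<lambda>x. norm (f x))"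
    using assms(3) by (simp add: norm_mult)
  also have "\<dots> \<longleftrightarrow> integrable M f"
    by (rule integrable_norm_iff) measurable
  finally show ?thesis .
qed

lemma fan_shear_periodic:
  assumes w: "w \<in> fan_sinograms"
  shows "fan_shear w (\<gamma> + pi) (\<theta> + pi) = fan_shear w \<gamma> \<theta>"
    and "fan_shear w (\<gamma> + 2 * pi) \<theta> = fan_shear w \<gamma> \<theta>"
    and "fan_shear w \<gamma> (\<theta> + 2 * pi) = fan_shear w \<gamma> \<theta>"
proof -
  show "fan_shear w (\<gamma> + pi) (\<theta> + pi) = fan_shear w \<gamma> \<theta>"
    by (simp add: fan_shear_def fan_periodic[OF w])
  have "fan_shear w (\<gamma> + 2 * pi) \<theta> = w (\<gamma> + of_int 2 * pi) (\<theta> - \<gamma> - 2 * pi)"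
    by (simp add: fan_shear_def diff_diff_add)
  also have "\<dots> = w \<gamma> (\<theta> - \<gamma> - 2 * pi)"
    by (rule fan_periodic[OF w])
  also have "\<dots> = fan_shear w \<gamma> \<theta>"
    using fan_periodic(3)[OF w, of \<gamma> "\<theta> - \<gamma> - 2 * pi"] by (simp add: fan_shear_def)
  finally show "fan_shear w (\<gamma> + 2 * pi) \<theta> = fan_shear w \<gamma> \<theta>" .
  show "fan_shear w \<gamma> (\<theta> + 2 * pi) = fan_shear w \<gamma> \<theta>"
    using fan_periodic(3)[OF w, of \<gamma> "\<theta> - \<gamma>"] by (simp add: fan_shear_def algebra_simps)
qed

lemma fan_shear_measurable:
  assumes w: "w \<in> fan_sinograms" and [measurable]: "f \<in> borel_measurable M" "g \<in> borel_measurable M"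
  shows "(\<lambda>x. fan_shear w (f x) (g x)) \<in> borel_measurable M"
  unfolding fan_shear_def by (rule fan_measurable[OF w]) measurable

lemma fan_shear_integrable:
  assumes w: "w \<in> fan_sinograms"
  shows "integrable (lborel \<Otimes>\<^sub>M lborel)
    (\<lambda>(\<gamma>, \<theta>). indicator {0..2 * pi} \<gamma> * indicator {0..2 * pi} \<theta> * fan_shear w \<gamma> \<theta>)"
proof (rule integrableI_bounded)
  note [measurable] = fan_measurable[OF w] fan_shear_measurable[OF w]
  show "(\<lambda>(\<gamma>, \<theta>). indicator {0..2 * pi} \<gamma> * indicator {0..2 * pi} \<theta> * fan_shear w \<gamma> \<theta>) \<in> borel_measurable (lborel \<Otimes>\<^sub>M lborel)"
    by measurable
  have "(\<integral>\<^sup>+q. ennreal (norm (case q of (\<gamma>, \<theta>) \<Rightarrow> indicator {0..2 * pi} \<gamma> * indicator {0..2 * pi} \<theta> * fan_shear w \<gamma> \<theta>)) \<partial>(lborel \<Otimes>\<^sub>M lborel))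
    = (\<integral>\<^sup>+\<gamma>. \<integral>\<^sup>+\<theta>. ennreal \<bar>fan_shear w \<gamma> \<theta>\<bar> * indicator {0..2 * pi} \<theta> * indicator {0..2 * pi} \<gamma> \<partial>lborel \<partial>lborel)"
    by (subst lborel.nn_integral_fst[symmetric]) (auto intro!: nn_integral_cong split: split_indicator)
  also have "\<dots> = (\<integral>\<^sup>+\<gamma>\<in>{0..2 * pi}. (\<integral>\<^sup>+\<theta>\<in>{0..2 * pi}. ennreal \<bar>fan_shear w \<gamma> \<theta>\<bar> \<partial>lborel) \<partial>lborel)"
    by (subst nn_integral_multc) auto
  also have "(\<lambda>\<gamma>. \<integral>\<^sup>+\<theta>\<in>{0..2 * pi}. ennreal \<bar>fan_shear w \<gamma> \<theta>\<bar> \<partial>lborel)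
      = (\<lambda>\<gamma>. \<integral>\<^sup>+\<beta>\<in>{0..2 * pi}. ennreal \<bar>w \<gamma> \<beta>\<bar> \<partial>lborel)"
  proof
    fix \<gamma>
    have "(\<integral>\<^sup>+\<theta>\<in>{0..2 * pi}. ennreal \<bar>fan_shear w \<gamma> \<theta>\<bar> \<partial>lborel)
        = ennreal \<bar>1\<bar> * (\<integral>\<^sup>+\<beta>. ennreal \<bar>fan_shear w \<gamma> (\<gamma> + 1 * \<beta>)\<bar> * indicator {0..2 * pi} (\<gamma> + 1 * \<beta>) \<partial>lborel)"
      by (rule nn_integral_real_affine) auto
    also have "\<dots> = (\<integral>\<^sup>+\<beta>\<in>{- \<gamma>..- \<gamma> + 2 * pi}. ennreal \<bar>w \<gamma> \<beta>\<bar> \<partial>lborel)"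
      by (auto intro!: nn_integral_cong simp: fan_shear_def split: split_indicator)
    also have "\<dots> = (\<integral>\<^sup>+\<beta>\<in>{0..2 * pi}. ennreal \<bar>w \<gamma> \<beta>\<bar> \<partial>lborel)"
      by (rule nn_integral_periodic) (auto simp: fan_periodic(3)[OF w])
    finally show "(\<integral>\<^sup>+\<theta>\<in>{0..2 * pi}. ennreal \<bar>fan_shear w \<gamma> \<theta>\<bar> \<partial>lborel)
        = (\<integral>\<^sup>+\<beta>\<in>{0..2 * pi}. ennreal \<bar>w \<gamma> \<beta>\<bar> \<partial>lborel)" .
  qed
  finally show "(\<integral>\<^sup>+q. ennreal (norm (case q of (\<gamma>, \<theta>) \<Rightarrow> indicator {0..2 * pi} \<gamma> * indicator {0..2 * pi} \<theta> * fan_shear w \<gamma> \<theta>)) \<partial>(lborel \<Otimes>\<^sub>M lborel)) < \<infinity>"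
    using fan_nn_integral_finite[OF w] by simp
qed

text \<open>The closed form of the series: \<open>\<sigma>\<close> times the Fourier transform of the backprojection at
  \<open>\<sigma> *\<^sub>R unit_vec \<theta>\<close>. It is also used for negative \<open>\<sigma>\<close>.\<close>

definition fan_phase_integral :: "real \<Rightarrow> (real \<Rightarrow> real \<Rightarrow> real) \<Rightarrow> real \<Rightarrow> real \<Rightarrow> complex" where
  "fan_phase_integral D w \<sigma> \<theta> =
    (LINT \<gamma>:{0..2 * pi}|lborel. of_real (fan_shear w \<gamma> \<theta>) * exp (- \<i> * of_real (D * \<sigma> * sin \<gamma>)))"

text \<open>The Jacobi-Anger expansion integrated term by term. The statement holds for every \<open>\<theta>\<close>:
  if \<open>fan_shear w\<close> is not integrable in its first argument, all the integrals involved are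
  \<open>0\<close> by convention.\<close>

lemma fan_phase_integral_series:
  assumes w: "w \<in> fan_sinograms"
  shows "(\<lambda>n. fan_b w n \<theta> * complex_of_real (bessel_J n (D * \<sigma>))) sums fan_phase_integral D w \<sigma> \<theta>"
proof -
  note [measurable] = fan_shear_measurable[OF w]
  define x where "x = D * \<sigma>"
  define I where "I \<gamma> = indicator {0..2 * pi} \<gamma> * fan_shear w \<gamma> \<theta>" for \<gamma>
  have [measurable]: "I \<in> borel_measurable borel"
    unfolding I_def by measurable
  define E where "E n \<gamma> = exp (- \<i> * of_nat n * complex_of_real \<gamma>)" for n \<gamma>
  have [measurable]: "E n \<in> borel_measurable borel" for n
    unfolding E_def by measurable
  have normE: "norm (E n \<gamma>) = 1" for n \<gamma>
    using norm_exp_neg_ii[of "real n * \<gamma>"] by (simp add: E_def mult.assoc)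
  define P where "P n = (LINT \<gamma>|lborel. of_real (I \<gamma>) * E n \<gamma>)" for n
  have b: "fan_b w n \<theta> = (if n = 0 then P 0 else P n + (-1) ^ n * cnj (P n))" for n
  proof -
    have "of_real (2 * pi) * fan_c w n \<theta> = P n" for n
      by (simp add: fan_c_def P_def I_def E_def set_lebesgue_integral_def scaleR_conv_of_real mult.assoc)
    then show ?thesis
      by (auto simp: fan_b_def distrib_left simp flip: \<open>\<And>n. of_real (2 * pi) * fan_c w n \<theta> = P n\<close>)
  qed
  have G: "fan_phase_integral D w \<sigma> \<theta> = (LINT \<gamma>|lborel. of_real (I \<gamma>) * exp (- \<i> * of_real (x * sin \<gamma>)))"
    by (simp add: fan_phase_integral_def I_def x_def set_lebesgue_integral_def scaleR_conv_of_real mult.assoc)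
  show ?thesis
  proof (cases "integrable lborel I")
    case False
    have P0: "P n = 0" for n
      unfolding P_def using False integrable_unimodular_mult[of "E n" lborel I] normE
      by (intro not_integrable_integral_eq) simp
    have "fan_b w n \<theta> = 0" for n
      unfolding b by (simp add: P0)
    moreover have "fan_phase_integral D w \<sigma> \<theta> = 0"
      unfolding G using False integrable_unimodular_mult[of "\<lambda>\<gamma>. exp (- \<i> * of_real (x * sin \<gamma>))" lborel I]
      by (intro not_integrable_integral_eq) (simp del: mult_minus_left)
    ultimately show ?thesis by simp
  next
    case True
    define J where "J n = bessel_J n x" for n
    define f where "f n \<gamma> = of_real (I \<gamma>) * (of_real (J n) * (if n = 0 then 1 else E n \<gamma> + (-1) ^ n * cnj (E n \<gamma>)))" for n \<gamma>
    have J: "summable (\<lambda>n. \<bar>J n\<bar>)"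
      unfolding J_def by (rule jacobi_anger)
    have le: "norm (f n \<gamma>) \<le> 2 * \<bar>J n\<bar> * \<bar>I \<gamma>\<bar>" for n \<gamma>
    proof -
      have "norm (if n = 0 then 1 else E n \<gamma> + (-1) ^ n * cnj (E n \<gamma>)) \<le> 2"
        using norm_triangle_ineq[of "E n \<gamma>" "(-1) ^ n * cnj (E n \<gamma>)"] normE[of n \<gamma>]
        by (simp add: norm_mult norm_power)
      then have "\<bar>I \<gamma>\<bar> * (\<bar>J n\<bar> * norm (if n = 0 then 1 else E n \<gamma> + (-1) ^ n * cnj (E n \<gamma>)))
          \<le> \<bar>I \<gamma>\<bar> * (\<bar>J n\<bar> * 2)"
        by (intro mult_left_mono) auto
      then show ?thesis by (simp add: f_def norm_mult mult_ac)
    qed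
    have [measurable]: "cnj \<in> borel_measurable borel"
      by (intro borel_measurable_continuous_onI continuous_on_cnj continuous_on_id)
    have [measurable]: "f n \<in> borel_measurable borel" for n
      unfolding f_def by (cases "n = 0") simp_all
    have int: "integrable lborel (f n)" for n
      by (rule Bochner_Integration.integrable_bound[of lborel "\<lambda>\<gamma>. 2 * \<bar>J n\<bar> * \<bar>I \<gamma>\<bar>"])
        (use True le in \<open>auto intro!: AE_I2\<close>)
    have sums: "(\<lambda>n. f n \<gamma>) sums (of_real (I \<gamma>) * exp (- \<i> * of_real (x * sin \<gamma>)))" for \<gamma>
      unfolding f_def J_def E_def by (intro sums_mult jacobi_anger)
    have "(\<lambda>n. integral\<^sup>L lborel (f n)) sums (LINT \<gamma>|lborel. (\<Sum>n. f n \<gamma>))"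
    proof (rule sums_integral[OF int])
      show "AE \<gamma> in lborel. summable (\<lambda>n. norm (f n \<gamma>))"
      proof (rule AE_I2)
        fix \<gamma>
        have "summable (\<lambda>n. 2 * \<bar>J n\<bar> * \<bar>I \<gamma>\<bar>)"
          using J by (intro summable_mult2 summable_mult)
        then show "summable (\<lambda>n. norm (f n \<gamma>))"
          by (rule summable_comparison_test') (use le in auto)
      qed
      have "summable (\<lambda>n. 2 * \<bar>J n\<bar> * (LINT \<gamma>|lborel. \<bar>I \<gamma>\<bar>))"
        using J by (intro summable_mult2 summable_mult)
      then show "summable (\<lambda>n. LINT \<gamma>|lborel. norm (f n \<gamma>))"
      proof (rule summable_comparison_test')
        fix n
        have "(LINT \<gamma>|lborel. norm (f n \<gamma>)) \<le> (LINT \<gamma>|lborel. 2 * \<bar>J n\<bar> * \<bar>I \<gamma>\<bar>)"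
          using True le by (intro integral_mono integrable_norm int) auto
        then show "norm (LINT \<gamma>|lborel. norm (f n \<gamma>)) \<le> 2 * \<bar>J n\<bar> * (LINT \<gamma>|lborel. \<bar>I \<gamma>\<bar>)"
          by simp
      qed
    qed
    also have "(LINT \<gamma>|lborel. (\<Sum>n. f n \<gamma>)) = fan_phase_integral D w \<sigma> \<theta>"
      unfolding G by (simp add: sums_unique[OF sums, symmetric])
    also have "(\<lambda>n. integral\<^sup>L lborel (f n)) = (\<lambda>n. fan_b w n \<theta> * complex_of_real (J n))"
    proof
      fix n
      have intE: "integrable lborel (\<lambda>\<gamma>. of_real (I \<gamma>) * E n \<gamma>)"
        using True normE by (subst integrable_unimodular_mult) auto
      have "integral\<^sup>L lborel (f n) = (if n = 0 then P 0 else P n + (-1) ^ n * cnj (P n)) * of_real (J n)"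
      proof (cases "n = 0")
        case True
        have "E 0 \<gamma> = 1" for \<gamma> by (simp add: E_def)
        then show ?thesis using True by (simp add: f_def[abs_def] P_def)
      next
        case False
        have "f n = (\<lambda>\<gamma>. of_real (J n) * (of_real (I \<gamma>) * E n \<gamma> + (-1) ^ n * cnj (of_real (I \<gamma>) * E n \<gamma>)))"
          using False by (simp add: f_def fun_eq_iff algebra_simps)
        then have "integral\<^sup>L lborel (f n)
            = of_real (J n) * (P n + (-1) ^ n * (LINT \<gamma>|lborel. cnj (of_real (I \<gamma>) * E n \<gamma>)))"
          using intE unfolding P_def by (simp del: complex_cnj_mult)
        also have "(LINT \<gamma>|lborel. cnj (of_real (I \<gamma>) * E n \<gamma>)) = cnj (P n)"
          unfolding P_def by (rule integral_bounded_linear[OF bounded_linear_cnj intE])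
        finally show ?thesis using False by simp
      qed
      then show "integral\<^sup>L lborel (f n) = fan_b w n \<theta> * complex_of_real (J n)"
        by (simp add: b)
    qed
    finally show ?thesis by (simp add: J_def x_def)
  qed
qed

lemma fan_phase_integral_periodic:
  assumes w: "w \<in> fan_sinograms"
  shows "fan_phase_integral D w \<sigma> (\<theta> + of_int k * (2 * pi)) = fan_phase_integral D w \<sigma> \<theta>"
  by (rule periodic_of_int) (simp add: fan_phase_integral_def fan_shear_periodic[OF w])

text \<open>The polar coordinates \<open>(- \<sigma>, \<theta> + pi)\<close> and \<open>(\<sigma>, \<theta>)\<close> denote the same frequency.\<close>

lemma fan_phase_integral_reflect:
  assumes w: "w \<in> fan_sinograms"
  shows "fan_phase_integral D w (- \<sigma>) (\<theta> + pi) = fan_phase_integral D w \<sigma> \<theta>"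
proof -
  note [measurable] = fan_shear_measurable[OF w]
  let ?h = "\<lambda>\<gamma>. of_real (fan_shear w \<gamma> (\<theta> + pi)) * exp (- \<i> * of_real (D * - \<sigma> * sin \<gamma>))"
  have "fan_phase_integral D w (- \<sigma>) (\<theta> + pi) = (LINT \<gamma>:{pi..pi + 2 * pi}|lborel. ?h \<gamma>)"
    unfolding fan_phase_integral_def
    by (rule periodic_integral(2)[symmetric]) (auto simp: fan_shear_periodic[OF w])
  also have "\<dots> = (LINT \<gamma>:{0 + pi..2 * pi + pi}|lborel. ?h \<gamma>)"
    by (simp add: add.commute)
  also have "\<dots> = (LINT \<gamma>:{0..2 * pi}|lborel. ?h (\<gamma> + pi))"
    by (rule set_integral_shift)
  also have "\<dots> = fan_phase_integral D w \<sigma> \<theta>"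
    by (simp add: fan_phase_integral_def fan_shear_periodic[OF w])
  finally show ?thesis .
qed

text \<open>A measurable choice of the polar angle, with values in \<open>{-pi..pi}\<close>.\<close>

definition polar_angle :: "real^2 \<Rightarrow> real" where
  "polar_angle x = (if x $ 2 \<ge> 0 then clamped_arccos (x $ 1 / norm x) else - clamped_arccos (x $ 1 / norm x))"

lemma measurable_polar_angle [measurable]: "polar_angle \<in> borel_measurable borel"
proof -
  have [measurable]: "(\<lambda>x::real^2. x $ i) \<in> borel_measurable borel" for i
    by (intro borel_measurable_continuous_onI continuous_intros)
  show ?thesis unfolding polar_angle_def by measurable
qed

lemma polar_angle_unit_vec:
  assumes "\<sigma> > 0"
  shows "\<exists>k::int. polar_angle (\<sigma> *\<^sub>R unit_vec \<theta>) = \<theta> + of_int k * (2 * pi)"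
proof -
  define c where "c = arccos (cos \<theta>)"
  have c: "polar_angle (\<sigma> *\<^sub>R unit_vec \<theta>) = (if sin \<theta> \<ge> 0 then c else - c)"
    using assms by (simp add: polar_angle_def c_def clamped_arccos zero_le_mult_iff)
  have cosc: "cos c = cos \<theta>" by (simp add: c_def)
  have sinc: "sin c = \<bar>sin \<theta>\<bar>"
    by (simp add: c_def sin_arccos_abs sin_squared_eq[symmetric] del: sin_squared_eq)
  have "sin (polar_angle (\<sigma> *\<^sub>R unit_vec \<theta>)) = sin \<theta> \<and> cos (polar_angle (\<sigma> *\<^sub>R unit_vec \<theta>)) = cos \<theta>"
    by (simp add: c cosc sinc)
  then obtain n :: int where "polar_angle (\<sigma> *\<^sub>R unit_vec \<theta>) = \<theta> + 2 * pi * n"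
    unfolding sin_cos_eq_iff by blast
  then show ?thesis by (intro exI[of _ n]) simp
qed

text \<open>The function that represents the Fourier transform of the backprojection. Its value at the
  frequency \<open>0\<close> is \<open>0\<close>, because \<open>1 / 0 = 0\<close>.\<close>

definition fan_adjoint_ft :: "real \<Rightarrow> (real \<Rightarrow> real \<Rightarrow> real) \<Rightarrow> real^2 \<Rightarrow> complex" where
  "fan_adjoint_ft D w \<omega> = 1 / of_real (norm \<omega>) * fan_phase_integral D w (norm \<omega>) (polar_angle \<omega>)"

lemma fan_adjoint_ft_polar:
  assumes w: "w \<in> fan_sinograms" and "\<sigma> > 0"
  shows "fan_adjoint_ft D w (\<sigma> *\<^sub>R unit_vec \<theta>) = 1 / of_real \<sigma> * fan_phase_integral D w \<sigma> \<theta>"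
proof -
  obtain k :: int where "polar_angle (\<sigma> *\<^sub>R unit_vec \<theta>) = \<theta> + of_int k * (2 * pi)"
    using polar_angle_unit_vec[OF \<open>\<sigma> > 0\<close>] by blast
  then show ?thesis
    using \<open>\<sigma> > 0\<close> by (simp add: fan_adjoint_ft_def fan_phase_integral_periodic[OF w])
qed

lemma fan_adjoint_ft_signed_polar:
  assumes w: "w \<in> fan_sinograms" and "r \<noteq> 0"
  shows "of_real \<bar>r\<bar> * fan_adjoint_ft D w (r *\<^sub>R unit_vec \<theta>) = fan_phase_integral D w r \<theta>"
proof (cases "r > 0")
  case True
  then show ?thesis by (simp add: fan_adjoint_ft_polar[OF w])
next
  case False
  then have r: "- r > 0" using \<open>r \<noteq> 0\<close> by simp
  have "r *\<^sub>R unit_vec \<theta> = (- r) *\<^sub>R unit_vec (\<theta> + pi)" by simp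
  then have "of_real \<bar>r\<bar> * fan_adjoint_ft D w (r *\<^sub>R unit_vec \<theta>) = fan_phase_integral D w (- r) (\<theta> + pi)"
    using r fan_adjoint_ft_polar[OF w r, of D "\<theta> + pi"] by simp
  then show ?thesis by (simp add: fan_phase_integral_reflect[OF w])
qed

section \<open>The two sides of the duality\<close>

text \<open>The one-dimensional Fourier transform of \<open>f\<close> restricted to the line through the origin in
  direction \<open>\<theta>\<close>, at the frequency \<open>D sin \<gamma>\<close>, the signed distance of the ray with fan angle \<open>\<gamma>\<close> from the origin.\<close>

definition line_fourier :: "real \<Rightarrow> (real^2 \<Rightarrow> complex) \<Rightarrow> real \<Rightarrow> real \<Rightarrow> complex" where
  "line_fourier D f \<gamma> \<theta> = (LINT s|lborel. f (s *\<^sub>R unit_vec \<theta>) * exp (- \<i> * of_real (D * s * sin \<gamma>)))"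

lemma line_fourier_measurable:
  assumes f: "f \<in> schwartz_space"
  shows "(\<lambda>q. line_fourier D f (fst q) (snd q)) \<in> borel_measurable (lborel \<Otimes>\<^sub>M lborel)"
proof -
  note [measurable] = schwartz_measurable[OF f]
  show ?thesis unfolding line_fourier_def by measurable
qed

lemma line_fourier_bound:
  assumes f: "f \<in> schwartz_space"
  obtains B where "\<And>\<gamma> \<theta>. norm (line_fourier D f \<gamma> \<theta>) \<le> B"
proof -
  obtain C where C: "C \<ge> 0" "\<And>s a. norm (f (s *\<^sub>R unit_vec a)) \<le> C * (1 / (1 + s\<^sup>2))"
    using schwartz_ray_decay[OF f] by metis
  have int: "integrable lborel (\<lambda>s. C * (1 / (1 + s\<^sup>2)))"
    by (intro integrable_mult_right integrable_inverse_1_plus_square_real)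
  note [measurable] = schwartz_measurable[OF f]
  have "norm (line_fourier D f \<gamma> \<theta>) \<le> (LINT s|lborel. C * (1 / (1 + s\<^sup>2)))" for \<gamma> \<theta>
    unfolding line_fourier_def
  proof (rule Bochner_Integration.integral_norm_bound_integral[OF _ int])
    have le: "norm (f (s *\<^sub>R unit_vec \<theta>) * exp (- \<i> * of_real (D * s * sin \<gamma>))) \<le> C * (1 / (1 + s\<^sup>2))" for s
      using C(2)[of s \<theta>] by (simp only: norm_mult norm_exp_neg_ii mult_1_right)
    then show "norm (f (s *\<^sub>R unit_vec \<theta>) * exp (- \<i> * of_real (D * s * sin \<gamma>))) \<le> C * (1 / (1 + s\<^sup>2))" for s .
    show "integrable lborel (\<lambda>s. f (s *\<^sub>R unit_vec \<theta>) * exp (- \<i> * of_real (D * s * sin \<gamma>)))"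
      by (rule Bochner_Integration.integrable_bound[OF int], measurable,
          intro AE_I2 order_trans[OF le]) (simp only: real_norm_def abs_ge_self)
  qed
  then show ?thesis by (rule that)
qed

lemma line_fourier_integrable:
  assumes f: "f \<in> schwartz_space"
    and h: "integrable (lborel \<Otimes>\<^sub>M lborel) (\<lambda>q. h (fst q) (snd q) :: real)"
    and [measurable]: "a \<in> borel_measurable (lborel \<Otimes>\<^sub>M lborel)"
  shows "integrable (lborel \<Otimes>\<^sub>M lborel) (\<lambda>q. of_real (h (fst q) (snd q) / 2) * line_fourier D f (fst q) (a q))"
proof -
  obtain B where B: "\<And>\<gamma> \<theta>. norm (line_fourier D f \<gamma> \<theta>) \<le> B"
    using line_fourier_bound[OF f] by metis
  have B0: "B \<ge> 0" using order_trans[OF norm_ge_zero B] .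
  have [measurable]: "(\<lambda>q. h (fst q) (snd q)) \<in> borel_measurable (lborel \<Otimes>\<^sub>M lborel)"
    using h by auto
  have "(\<lambda>q. (fst q, a q)) \<in> measurable (lborel \<Otimes>\<^sub>M lborel) (lborel \<Otimes>\<^sub>M lborel)"
    by measurable
  from measurable_compose[OF this line_fourier_measurable[OF f, of D]]
  have [measurable]: "(\<lambda>q. line_fourier D f (fst q) (a q)) \<in> borel_measurable (lborel \<Otimes>\<^sub>M lborel)"
    by simp
  show ?thesis
  proof (rule Bochner_Integration.integrable_bound)
    show "integrable (lborel \<Otimes>\<^sub>M lborel) (\<lambda>q. B * h (fst q) (snd q))"
      using h by simp
    show "AE q in lborel \<Otimes>\<^sub>M lborel. norm (of_real (h (fst q) (snd q) / 2) * line_fourier D f (fst q) (a q))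
        \<le> norm (B * h (fst q) (snd q))"
    proof (rule AE_I2)
      fix q
      have "\<bar>h (fst q) (snd q)\<bar> / 2 * norm (line_fourier D f (fst q) (a q)) \<le> \<bar>h (fst q) (snd q)\<bar> * B"
        using B[of "fst q" "a q"] by (intro mult_mono) auto
      then show "norm (of_real (h (fst q) (snd q) / 2) * line_fourier D f (fst q) (a q)) \<le> norm (B * h (fst q) (snd q))"
        using B0 by (simp add: norm_mult norm_divide abs_mult mult.commute)
    qed
  qed measurable
qed

lemma source_inner: "source D \<beta> \<bullet> unit_vec (\<beta> + \<gamma>) = D * sin \<gamma>"
proof -
  have "source D \<beta> \<bullet> unit_vec (\<beta> + \<gamma>) = D * cos (pi / 2 - \<gamma>)"
    by (simp add: source_eq inner_unit_vec)
  then show ?thesis by (simp add: cos_diff)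
qed

text \<open>The projection slice theorem applied to every ray, followed by the change of variables
  \<open>\<theta> = \<beta> + \<gamma>\<close>, which turns \<open>w\<close> into \<open>fan_shear w\<close>.\<close>

lemma fan_adjoint_shear_pairing:
  assumes D: "D > 0" and w: "w \<in> fan_sinograms" and f: "f \<in> schwartz_space"
  shows "(LINT x|lborel. complex_of_real (fan_adjoint D w x) * fourier2 f x)
    = (LINT \<gamma>|lborel. LINT \<theta>|lborel.
        of_real (indicator {0..2 * pi} \<gamma> * indicator {0..2 * pi} \<theta> * fan_shear w \<gamma> \<theta> / 2) * line_fourier D f \<gamma> \<theta>)"
proof -
  let ?I = "indicator {0..2 * pi} :: real \<Rightarrow> real"
  note [measurable] = schwartz_measurable[OF f] fan_shear_measurable[OF w]
  have slice: "(LINT r|lborel. fourier2 f (source D \<beta> + r *\<^sub>R unit_vec (\<beta> + pi / 2 + \<gamma>))) = line_fourier D f \<gamma> (\<beta> + \<gamma>)" for \<beta> \<gamma>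
  proof -
    have comm: "\<beta> + pi / 2 + \<gamma> = \<beta> + \<gamma> + pi / 2" by simp
    show ?thesis
      unfolding comm using projection_slice[OF f, of "source D \<beta>" "\<beta> + \<gamma>"]
      by (simp add: line_fourier_def source_inner mult_ac)
  qed
  let ?k = "\<lambda>\<gamma> \<beta>. of_real (?I \<gamma> * ?I \<beta> * w \<gamma> \<beta> / 2) * line_fourier D f \<gamma> (\<beta> + \<gamma>)"
  have "integrable (lborel \<Otimes>\<^sub>M lborel) (\<lambda>q. ?k (fst q) (snd q))"
    by (rule line_fourier_integrable[OF f, of "\<lambda>\<gamma> \<beta>. ?I \<gamma> * ?I \<beta> * w \<gamma> \<beta>"])
      (use lborel_fan_integrable[OF w] in \<open>auto simp: case_prod_beta'\<close>)
  then have int: "integrable (lborel \<Otimes>\<^sub>M lborel) (\<lambda>(\<gamma>, \<beta>). ?k \<gamma> \<beta>)"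
    by (simp only: case_prod_beta')
  have "(LINT x|lborel. complex_of_real (fan_adjoint D w x) * fourier2 f x)
      = (LINT \<beta>|lborel. LINT \<gamma>|lborel. ?k \<gamma> \<beta>)"
    by (simp only: fan_adjoint_pairing(2)[OF D w f] slice)
  also have "\<dots> = (LINT \<gamma>|lborel. LINT \<beta>|lborel. ?k \<gamma> \<beta>)"
    by (rule lborel_pair.Fubini_integral[OF int])
  also have "\<dots> = (LINT \<gamma>|lborel. LINT \<theta>|lborel. of_real (?I \<gamma> * ?I \<theta> * fan_shear w \<gamma> \<theta> / 2) * line_fourier D f \<gamma> \<theta>)"
  proof (rule Bochner_Integration.integral_cong[OF refl])
    fix \<gamma>
    let ?z = "\<lambda>\<theta>. of_real (fan_shear w \<gamma> \<theta>) * line_fourier D f \<gamma> \<theta>"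
    have [measurable]: "line_fourier D f \<gamma> \<in> borel_measurable borel"
      unfolding line_fourier_def by measurable
    have "(LINT \<theta>:{0..2 * pi}|lborel. ?z \<theta>) = (LINT \<theta>:{\<gamma>..\<gamma> + 2 * pi}|lborel. ?z \<theta>)"
      by (rule periodic_integral(2)[symmetric]) (auto simp: fan_shear_periodic[OF w] line_fourier_def)
    also have "\<dots> = (LINT \<theta>:{0 + \<gamma>..2 * pi + \<gamma>}|lborel. ?z \<theta>)"
      by (simp add: add.commute)
    also have "\<dots> = (LINT \<beta>:{0..2 * pi}|lborel. ?z (\<beta> + \<gamma>))"
      by (rule set_integral_shift)
    finally have z: "(LINT \<theta>:{0..2 * pi}|lborel. ?z \<theta>) = (LINT \<beta>:{0..2 * pi}|lborel. ?z (\<beta> + \<gamma>))" .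
    have "(LINT \<beta>|lborel. ?k \<gamma> \<beta>) = of_real (?I \<gamma> / 2) * (LINT \<beta>:{0..2 * pi}|lborel. ?z (\<beta> + \<gamma>))"
      unfolding set_lebesgue_integral_def
      by (subst integral_mult_right_zero[symmetric])
        (simp add: fan_shear_def scaleR_conv_of_real mult_ac)
    also have "\<dots> = (LINT \<theta>|lborel. of_real (?I \<gamma> * ?I \<theta> * fan_shear w \<gamma> \<theta> / 2) * line_fourier D f \<gamma> \<theta>)"
      unfolding z[symmetric] unfolding set_lebesgue_integral_def
      by (subst integral_mult_right_zero[symmetric]) (simp add: scaleR_conv_of_real mult_ac)
    finally show "(LINT \<beta>|lborel. ?k \<gamma> \<beta>)
        = (LINT \<theta>|lborel. of_real (?I \<gamma> * ?I \<theta> * fan_shear w \<gamma> \<theta> / 2) * line_fourier D f \<gamma> \<theta>)" .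
  qed
  finally show ?thesis .
qed

text \<open>Polar coordinates in the frequency domain lead to the same double integral, in the
  opposite order.\<close>

lemma fan_adjoint_ft_pairing:
  assumes w: "w \<in> fan_sinograms" and f: "f \<in> schwartz_space"
  shows "integrable lborel (\<lambda>\<omega>. fan_adjoint_ft D w \<omega> * f \<omega>)"
    and "(LINT \<omega>|lborel. fan_adjoint_ft D w \<omega> * f \<omega>)
      = (LINT \<theta>|lborel. LINT \<gamma>|lborel.
        of_real (indicator {0..2 * pi} \<gamma> * indicator {0..2 * pi} \<theta> * fan_shear w \<gamma> \<theta> / 2) * line_fourier D f \<gamma> \<theta>)"
proof -
  let ?I = "indicator {0..2 * pi} :: real \<Rightarrow> real"
  note [measurable] = schwartz_measurable[OF f] fan_shear_measurable[OF w]
  obtain C where C: "C \<ge> 0" "\<And>s a. norm (f (s *\<^sub>R unit_vec a)) \<le> C * (1 / (1 + s\<^sup>2))"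
    using schwartz_ray_decay[OF f] by metis
  have mG: "(\<lambda>q. fan_phase_integral D w (fst q) (snd q)) \<in> borel_measurable (borel \<Otimes>\<^sub>M borel)"
    unfolding fan_phase_integral_def set_lebesgue_integral_def by measurable
  have "(\<lambda>\<omega>::real^2. (norm \<omega>, polar_angle \<omega>)) \<in> measurable borel (borel \<Otimes>\<^sub>M borel)"
    by measurable
  from measurable_compose[OF this mG]
  have [measurable]: "(\<lambda>\<omega>. fan_phase_integral D w (norm \<omega>) (polar_angle \<omega>)) \<in> borel_measurable borel"
    by simp
  have [measurable]: "fan_adjoint_ft D w \<in> borel_measurable borel"
    unfolding fan_adjoint_ft_def by measurable
  let ?f = "\<lambda>\<omega>. fan_adjoint_ft D w \<omega> * f \<omega>"
  have mf: "?f \<in> borel_measurable borel" by measurable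
  let ?M = "\<lambda>\<theta> r. (?I \<theta> * (\<bar>r\<bar> / 2)) *\<^sub>R ?f (0 + r *\<^sub>R unit_vec (0 + \<theta>))"
  \<comment> \<open>The polar weight cancels the factor \<open>1 / norm \<omega>\<close> of \<open>fan_adjoint_ft\<close>.\<close>
  have M: "?M \<theta> r = of_real (?I \<theta> / 2) * (fan_phase_integral D w r \<theta> * f (r *\<^sub>R unit_vec \<theta>))" if "r \<noteq> 0" for \<theta> r
    using fan_adjoint_ft_signed_polar[OF w that, of D \<theta>, symmetric] by (simp add: scaleR_conv_of_real[where 'a = complex])
  define Z where "Z \<theta> = (LINT \<gamma>|lborel. \<bar>?I \<gamma> * ?I \<theta> * fan_shear w \<gamma> \<theta>\<bar>)" for \<theta>
  have intz: "integrable (lborel \<Otimes>\<^sub>M lborel) (\<lambda>(\<gamma>, \<theta>). ?I \<gamma> * ?I \<theta> * fan_shear w \<gamma> \<theta>)"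
    by (rule fan_shear_integrable[OF w])
  have "integrable (lborel \<Otimes>\<^sub>M lborel) (\<lambda>(\<gamma>, \<theta>). \<bar>?I \<gamma> * ?I \<theta> * fan_shear w \<gamma> \<theta>\<bar>)"
    using integrable_norm[OF intz] by (simp add: case_prod_beta')
  then have intZ: "integrable lborel Z"
    unfolding Z_def by (rule lborel_pair.integrable_snd)
  \<comment> \<open>A bound that is uniform in \<open>r\<close> and, as a function of \<open>\<theta>\<close>, integrable.\<close>
  have G_le: "norm (of_real (?I \<theta>) * fan_phase_integral D w r \<theta>) \<le> Z \<theta>" for \<theta> r
  proof -
    have "of_real (?I \<theta>) * fan_phase_integral D w r \<theta>
        = (LINT \<gamma>|lborel. of_real (?I \<gamma> * ?I \<theta> * fan_shear w \<gamma> \<theta>) * exp (- \<i> * of_real (D * r * sin \<gamma>)))"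
      unfolding fan_phase_integral_def set_lebesgue_integral_def
      by (subst integral_mult_right_zero[symmetric]) (simp add: scaleR_conv_of_real mult_ac)
    then have "norm (of_real (?I \<theta>) * fan_phase_integral D w r \<theta>)
        \<le> (LINT \<gamma>|lborel. norm (of_real (?I \<gamma> * ?I \<theta> * fan_shear w \<gamma> \<theta>) * exp (- \<i> * of_real (D * r * sin \<gamma>))))"
      by (simp only: integral_norm_bound)
    then show ?thesis
      unfolding Z_def by (simp only: norm_mult norm_exp_neg_ii mult_1_right norm_of_real)
  qed
  have intM: "integrable (lborel \<Otimes>\<^sub>M lborel) (\<lambda>(\<theta>, r). ?M \<theta> r)"
  proof (rule Bochner_Integration.integrable_bound)
    show "integrable (lborel \<Otimes>\<^sub>M lborel) (\<lambda>(\<theta>, r). Z \<theta> * (C * (1 / (1 + r\<^sup>2))))"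
      by (intro integrable_lborel_product intZ integrable_mult_right integrable_inverse_1_plus_square_real)
    have le: "norm (?M \<theta> r) \<le> Z \<theta> * (C * (1 / (1 + r\<^sup>2)))" for \<theta> r
    proof (cases "r = 0")
      case True
      have "Z \<theta> \<ge> 0" unfolding Z_def by simp
      then show ?thesis using True C(1) by simp
    next
      case False
      have "norm (?M \<theta> r) = norm (of_real (?I \<theta>) * fan_phase_integral D w r \<theta>) / 2 * norm (f (r *\<^sub>R unit_vec \<theta>))"
        unfolding M[OF False] by (simp add: norm_mult norm_divide)
      also have "\<dots> \<le> Z \<theta> * (C * (1 / (1 + r\<^sup>2)))"
        using G_le[of \<theta> r] norm_ge_zero[of "of_real (?I \<theta>) * fan_phase_integral D w r \<theta>"]
        by (intro mult_mono C(2) norm_ge_zero) linarith+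
      finally show ?thesis .
    qed
    show "AE q in lborel \<Otimes>\<^sub>M lborel. norm (case q of (\<theta>, r) \<Rightarrow> ?M \<theta> r)
        \<le> norm (case q of (\<theta>, r) \<Rightarrow> Z \<theta> * (C * (1 / (1 + r\<^sup>2))))"
      unfolding case_prod_beta' by (intro AE_I2 order_trans[OF le]) (simp only: real_norm_def abs_ge_self)
  qed measurable
  show "integrable lborel ?f"
    using intM integral_polar(1)[OF mf, of 0 0] by blast
  have "integral\<^sup>L lborel ?f = (LINT \<theta>|lborel. LINT r|lborel. ?M \<theta> r)"
    using integral_polar(2)[OF mf, of 0 0] lborel_pair.integral_fst[OF intM] by metis
  also have "\<dots> = (LINT \<theta>|lborel. LINT \<gamma>|lborel. of_real (?I \<gamma> * ?I \<theta> * fan_shear w \<gamma> \<theta> / 2) * line_fourier D f \<gamma> \<theta>)"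
  proof (rule integral_cong_AE)
    have "AE \<theta> in lborel. integrable lborel (\<lambda>\<gamma>. ?I \<gamma> * ?I \<theta> * fan_shear w \<gamma> \<theta>)"
      by (rule lborel_pair.AE_integrable_snd[OF intz])
    then show "AE \<theta> in lborel. (LINT r|lborel. ?M \<theta> r)
        = (LINT \<gamma>|lborel. of_real (?I \<gamma> * ?I \<theta> * fan_shear w \<gamma> \<theta> / 2) * line_fourier D f \<gamma> \<theta>)"
    proof eventually_elim
      case (elim \<theta>)
      let ?z = "\<lambda>\<gamma>. ?I \<gamma> * ?I \<theta> * fan_shear w \<gamma> \<theta> / 2"
      let ?h = "\<lambda>r \<gamma>. of_real (?z \<gamma>) * (f (r *\<^sub>R unit_vec \<theta>) * exp (- \<i> * of_real (D * r * sin \<gamma>)))"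
      have "AE r in lborel. r \<noteq> (0::real)" by (rule AE_lborel_singleton)
      then have AE: "AE r in lborel. ?M \<theta> r = (LINT \<gamma>|lborel. ?h r \<gamma>)"
      proof (rule eventually_mono)
        fix r :: real assume "r \<noteq> 0"
        have "(LINT \<gamma>|lborel. ?h r \<gamma>)
            = of_real (?I \<theta> / 2) * f (r *\<^sub>R unit_vec \<theta>) * fan_phase_integral D w r \<theta>"
          unfolding fan_phase_integral_def set_lebesgue_integral_def
          by (subst integral_mult_right_zero[symmetric]) (simp add: scaleR_conv_of_real mult_ac)
        then show "?M \<theta> r = (LINT \<gamma>|lborel. ?h r \<gamma>)"
          unfolding M[OF \<open>r \<noteq> 0\<close>] by (simp add: mult_ac)
      qed
      have int: "integrable (lborel \<Otimes>\<^sub>M lborel) (\<lambda>(r, \<gamma>). ?h r \<gamma>)"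
      proof (rule Bochner_Integration.integrable_bound)
        show "integrable (lborel \<Otimes>\<^sub>M lborel) (\<lambda>(r, \<gamma>). C * (1 / (1 + r\<^sup>2)) * ?z \<gamma>)"
          using elim by (intro integrable_lborel_product integrable_mult_right integrable_inverse_1_plus_square_real) simp
        show "AE q in lborel \<Otimes>\<^sub>M lborel. norm (case q of (r, \<gamma>) \<Rightarrow> ?h r \<gamma>)
            \<le> norm (case q of (r, \<gamma>) \<Rightarrow> C * (1 / (1 + r\<^sup>2)) * ?z \<gamma>)"
        proof (rule AE_I2, unfold case_prod_beta')
          fix q :: "real \<times> real"
          have "norm (?h (fst q) (snd q)) = \<bar>?z (snd q)\<bar> * norm (f (fst q *\<^sub>R unit_vec \<theta>))"
            by (simp only: norm_mult norm_exp_neg_ii mult_1_right norm_of_real)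
          also have "\<dots> \<le> \<bar>?z (snd q)\<bar> * (C * (1 / (1 + (fst q)\<^sup>2)))"
            by (intro mult_left_mono C(2)) simp
          also have "\<dots> = norm (C * (1 / (1 + (fst q)\<^sup>2)) * ?z (snd q))"
            using C(1) by (simp add: abs_mult mult_ac)
          finally show "norm (?h (fst q) (snd q)) \<le> norm (C * (1 / (1 + (fst q)\<^sup>2)) * ?z (snd q))" .
        qed
      qed measurable
      have "(LINT r|lborel. ?M \<theta> r) = (LINT r|lborel. LINT \<gamma>|lborel. ?h r \<gamma>)"
        by (rule integral_cong_AE[OF _ _ AE]) measurable
      also have "\<dots> = (LINT \<gamma>|lborel. LINT r|lborel. ?h r \<gamma>)"
        by (rule lborel_pair.Fubini_integral[OF int, symmetric])
      also have "\<dots> = (LINT \<gamma>|lborel. of_real (?z \<gamma>) * line_fourier D f \<gamma> \<theta>)"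
        by (simp only: line_fourier_def integral_mult_right_zero)
      finally show ?case .
    qed
    show "(\<lambda>\<theta>. LINT r|lborel. ?M \<theta> r) \<in> borel_measurable lborel"
      by measurable
    show "(\<lambda>\<theta>. LINT \<gamma>|lborel. of_real (?I \<gamma> * ?I \<theta> * fan_shear w \<gamma> \<theta> / 2) * line_fourier D f \<gamma> \<theta>) \<in> borel_measurable lborel"
      unfolding line_fourier_def by measurable
  qed
  finally show "integral\<^sup>L lborel ?f = (LINT \<theta>|lborel. LINT \<gamma>|lborel. of_real (?I \<gamma> * ?I \<theta> * fan_shear w \<gamma> \<theta> / 2) * line_fourier D f \<gamma> \<theta>)" .
qed

lemma has_fourier2_fan_adjoint:
  assumes D: "D > 0" and w: "w \<in> fan_sinograms"
  shows "has_fourier2 (\<lambda>x. complex_of_real (fan_adjoint D w x)) (fan_adjoint_ft D w)"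
  unfolding has_fourier2_def
proof (intro ballI conjI)
  fix f assume f: "f \<in> schwartz_space"
  show "integrable lborel (\<lambda>x. complex_of_real (fan_adjoint D w x) * fourier2 f x)"
    by (rule fan_adjoint_pairing(1)[OF D w f])
  show "integrable lborel (\<lambda>\<omega>. fan_adjoint_ft D w \<omega> * f \<omega>)"
    by (rule fan_adjoint_ft_pairing(1)[OF w f])
  let ?I = "indicator {0..2 * pi} :: real \<Rightarrow> real"
  let ?k = "\<lambda>\<gamma> \<theta>. of_real (?I \<gamma> * ?I \<theta> * fan_shear w \<gamma> \<theta> / 2) * line_fourier D f \<gamma> \<theta>"
  have "integrable (lborel \<Otimes>\<^sub>M lborel) (\<lambda>q. ?k (fst q) (snd q))"
    by (rule line_fourier_integrable[OF f, of "\<lambda>\<gamma> \<theta>. ?I \<gamma> * ?I \<theta> * fan_shear w \<gamma> \<theta>"])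
      (use fan_shear_integrable[OF w] in \<open>auto simp: case_prod_beta'\<close>)
  then have "integrable (lborel \<Otimes>\<^sub>M lborel) (\<lambda>(\<gamma>, \<theta>). ?k \<gamma> \<theta>)"
    by (simp only: case_prod_beta')
  from lborel_pair.Fubini_integral[OF this]
  show "(LINT x|lborel. complex_of_real (fan_adjoint D w x) * fourier2 f x) = (LINT \<omega>|lborel. fan_adjoint_ft D w \<omega> * f \<omega>)"
    unfolding fan_adjoint_shear_pairing[OF D w f] fan_adjoint_ft_pairing(2)[OF w f] by (rule sym)
qed

theorem theorem2:
  fixes D :: real and w :: "real \<Rightarrow> real \<Rightarrow> real"
  assumes "D > 0" and "w \<in> fan_sinograms"
  shows "\<exists>F :: real^2 \<Rightarrow> complex.
    has_fourier2 (\<lambda>x. complex_of_real (fan_adjoint D w x)) F \<and>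
    (\<forall>\<sigma>>0. \<forall>\<theta>.
       summable (\<lambda>n. fan_b w n \<theta> * complex_of_real (bessel_J n (D * \<sigma>))) \<and>
       F (\<sigma> *\<^sub>R unit_vec \<theta>) =
         1 / complex_of_real \<sigma> *
         (\<Sum>n. fan_b w n \<theta> * complex_of_real (bessel_J n (D * \<sigma>))))"
proof (intro exI[of _ "fan_adjoint_ft D w"] conjI allI impI)
  show "has_fourier2 (\<lambda>x. complex_of_real (fan_adjoint D w x)) (fan_adjoint_ft D w)"
    by (rule has_fourier2_fan_adjoint[OF assms])
  fix \<sigma> \<theta> :: real assume "\<sigma> > 0"
  note s = fan_phase_integral_series[OF assms(2), of \<theta> D \<sigma>]
  show "summable (\<lambda>n. fan_b w n \<theta> * complex_of_real (bessel_J n (D * \<sigma>)))"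
    using s by (rule sums_summable)
  show "fan_adjoint_ft D w (\<sigma> *\<^sub>R unit_vec \<theta>) =
      1 / complex_of_real \<sigma> * (\<Sum>n. fan_b w n \<theta> * complex_of_real (bessel_J n (D * \<sigma>)))"
    unfolding fan_adjoint_ft_polar[OF assms(2) \<open>\<sigma> > 0\<close>] by (simp add: sums_unique[OF s, symmetric])
qed

end
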